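(* Consider the uplink of a cell-free XL-MIMO system with $M$ base stations (BSs), each with $N_r$ antennas, and $K$ user equipments (UEs), each with $N_s$ antennas, where the channel matrices $\mathbf{H}_{mk}\in\mathbb{C}^{N_r\times N_s}$, the data vectors, the noise, the estimates $\check{\mathbf{x}}_{mk}$ and $\hat{\mathbf{x}}_k$, and the matrices $\mathbf{Z}_{mk}$ and $\mathbf{T}_{mkm'l}$ are as described in the context. Suppose every BS uses maximum ratio (MR) combining, $\mathbf{V}_{mk}=\mathbf{H}_{mk}$ for all $m,k$. Define $$\mathbf{E}_{k,(1)}=\sqrt{p}\sum_{m=1}^M \mathbf{Z}_{mk},\qquad \boldsymbol{\Psi}_{k,(1)}=p\sum_{l=1}^K\sum_{m=1}^M\sum_{m'=1}^M \mathbf{T}_{mkm'l}-\mathbf{E}_{k,(1)}\mathbf{E}_{k,(1)}^H+\sigma_w^2\sum_{m=1}^M\mathbf{Z}_{mk},$$ and assume $\boldsymbol{\Psi}_{k,(1)}$ is invertible. Then an achievable spectral efficiency for UE $k$ in the cell-free XL-MIMO is $$\mathrm{SE}_k^{(1)}=\log_2\left|\mathbf{I}_{N_s}+\mathbf{E}_{k,(1)}^H\boldsymbol{\Psi}_{k,(1)}^{-1}\mathbf{E}_{k,(1)}\right|.$$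
   Context: System model. BS $m$ ($m=1,\dots,M$) has $N_r$ antennas and UE $k$ ($k=1,\dots,K$) has $N_s$ antennas. The channel from UE $k$ to BS $m$ is $\mathbf{H}_{mk}=\mathbf{U}_r^{(m)}\big(\boldsymbol{\Sigma}^{(mk)}\odot\mathbf{W}^{(mk)}\big)(\mathbf{U}_s^{(k)})^H$, where $\mathbf{U}_r^{(m)}\in\mathbb{C}^{N_r\times n_r}$, $\mathbf{U}_s^{(k)}\in\mathbb{C}^{N_s\times n_s}$ and $\boldsymbol{\Sigma}^{(mk)}\in\mathbb{R}^{n_r\times n_s}$ are deterministic, $\odot$ is the entrywise product, and $\mathbf{W}^{(mk)}$ has i.i.d. $\mathcal{CN}(0,1)$ entries, with the $\mathbf{W}^{(mk)}$ independent across all pairs $(m,k)$; thus $\mathrm{vec}(\mathbf{H}_{mk})\sim\mathcal{CN}(\mathbf{0},\mathbf{R}_{mk})$ for some covariance $\mathbf{R}_{mk}$, independently over $(m,k)$. UE $k$ transmits data $\mathbf{x}_k\sim\mathcal{CN}(\mathbf{0},\mathbf{I}_{N_s})$ with power $p$, the $\mathbf{x}_k$ being mutually independent and independent of the channels and noise. BS $m$ receives $\mathbf{y}_m=\sqrt{p}\sum_{k=1}^K\mathbf{H}_{mk}\mathbf{x}_k+\mathbf{n}_m$, where $\mathbf{n}_m\sim\mathcal{CN}(\mathbf{0},\sigma_w^2\mathbf{I}_{N_r})$ are independent of each other and of everything else. With combining matrices $\mathbf{V}_{mk}\in\mathbb{C}^{N_r\times N_s}$, BS $m$ forms the local estimate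 $\check{\mathbf{x}}_{mk}=\mathbf{V}_{mk}^H\mathbf{y}_m$ and sends it to a central processing unit, which forms $\hat{\mathbf{x}}_k=\frac1M\sum_{m=1}^M\check{\mathbf{x}}_{mk}$. "Achievable spectral efficiency" means a lower bound (in bit/s/Hz) on the mutual information $I(\mathbf{x}_k;\hat{\mathbf{x}}_k)$. Notation: $\mathbf{Z}_{mk}=\mathbb{E}\{\mathbf{H}_{mk}^H\mathbf{H}_{mk}\}\in\mathbb{C}^{N_s\times N_s}$ and $\mathbf{T}_{mkm'l}=\mathbb{E}\{\mathbf{H}_{mk}^H\mathbf{H}_{ml}\mathbf{H}_{m'l}^H\mathbf{H}_{m'k}\}\in\mathbb{C}^{N_s\times N_s}$; $|\cdot|$ denotes the determinant. *)

theory Defs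
  imports "HOL-Probability.Probability" "HOL-Analysis.Analysis"
begin

definition cadj :: "complex^'n^'m \<Rightarrow> complex^'m^'n" where
  "cadj A = (\<chi> i j. cnj (A $ j $ i))"

definition hadamard :: "real^'n^'m \<Rightarrow> complex^'n^'m \<Rightarrow> complex^'n^'m" where
  "hadamard S W = (\<chi> i j. complex_of_real (S $ i $ j) * W $ i $ j)"

definition complex_normal :: "real \<Rightarrow> complex measure" where
  "complex_normal v =
     distr (density lborel (normal_density 0 (sqrt (v / 2)))
              \<Otimes>\<^sub>M density lborel (normal_density 0 (sqrt (v / 2))))
           borel (\<lambda>(a, b). Complex a b)"

text \<open>Mutual information (base b) with values in the extended reals: it is the
  library notion (KL divergence of the joint law from the product of marginals)
  whenever that is finite, and +infinity otherwise (joint law not absolutely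
  continuous w.r.t. the product of marginals, or log-density not integrable).\<close>
definition mutual_information_ext ::
  "'w measure \<Rightarrow> real \<Rightarrow> 'b measure \<Rightarrow> 'c measure \<Rightarrow> ('w \<Rightarrow> 'b) \<Rightarrow> ('w \<Rightarrow> 'c) \<Rightarrow> ereal" where
  "mutual_information_ext P b S T X Y =
     (let Pr = distr P S X \<Otimes>\<^sub>M distr P T Y;
          Q = distr P (S \<Otimes>\<^sub>M T) (\<lambda>\<omega>. (X \<omega>, Y \<omega>))
      in if absolutely_continuous Pr Q \<and> integrable Q (entropy_density b Pr Q)
         then ereal (prob_space.mutual_information P b S T X Y)
         else \<infinity>)"

text \<open>Index set for all scalar random quantities of the model:
  entries of W^(mk), entries of x_k, entries of n_m.\<close>
datatype ('a, 'b, 's, 'r) rv_index =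
    W_ent nat nat 'a 'b
  | X_ent nat 's
  | N_ent nat 'r

end

theory Submission
  imports Defs
begin

text \<open>Let \<open>s = M xhat\<^sub>k\<close>. Independence of the channels from the centred data and noise gives
  \<open>E[s x\<^sub>k\<^sup>H] = E\<close> and \<open>E[s s\<^sup>H] = \<Psi> + E E\<^sup>H\<close>, so \<open>\<Psi>\<close> is the covariance of \<open>s - E x\<^sub>k\<close>.
  For every positive \<open>g\<close> whose integral against the product of the marginals is at most 1, Gibbs'
  inequality bounds the mutual information below by the mean of \<open>log g\<close> under the joint law. Take for \<open>g\<close> the
  ratio of posterior to prior of \<open>x\<^sub>k\<close> in the jointly Gaussian model with these second moments. The posterior
  precision is \<open>A = I + E\<^sup>H \<Psi>\<^sup>-\<^sup>1 E\<close>; hence \<open>log g\<close> is \<open>log (det A)\<close> plus a difference of two quadratic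
  forms, and each form has mean \<open>N\<^sub>s\<close> as soon as the second moments agree.\<close>

subsection \<open>Hermitian forms and matrices\<close>

text \<open>The sum \<open>s\<close> is not Gaussian: data and noise are multiplied by products and
  entries of random channels, so no usable formula for the joint law of \<open>x k\<close> and
  \<open>s\<close> is at hand. The bound therefore rests on two things only: the exact law of
  \<open>x k\<close>, and second moments. The choice of \<open>g\<close> respects this. For each
  fixed value of \<open>s\<close> it is a ratio of two Gaussian densities in the first argument
  whose denominator is the true density of \<open>x k\<close>, so it integrates to 1 against the law
  of \<open>x k\<close>, whatever the law of \<open>s\<close>. Its logarithm is a quadratic
  polynomial, so its mean sees second moments only. The determinant enters solely as the
  normalisation of the posterior. Since \<open>x k\<close> is given through a product of
  one-dimensional laws, this Gaussian integral is evaluated on the product itself: the factor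
  \<open>exp (|x|^2)\<close> removes the prior density, and the powers of pi in posterior and prior
  cancel. Only invertibility of \<Psi> is assumed; that it is Hermitian and positive semidefinite
  comes from its being a covariance. Finiteness of the mutual information is not known beforehand;
  where the divergence is undefined, its extended value is infinite and the bound is
  trivial.\<close>

definition cip :: "complex^'n \<Rightarrow> complex^'n \<Rightarrow> complex" where
  "cip u v = (\<Sum>i\<in>UNIV. cnj (u $ i) * v $ i)"

definition pos_def :: "complex^'n^'n \<Rightarrow> bool" where
  "pos_def A \<longleftrightarrow> cadj A = A \<and> (\<forall>v. v \<noteq> 0 \<longrightarrow> 0 < Re (cip v (A *v v)))"

lemma cadj_nth[simp]: "cadj A $ i $ j = cnj (A $ j $ i)"
  by (simp add: cadj_def)

lemma cadj_cadj[simp]: "cadj (cadj A) = A"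
  by (simp add: vec_eq_iff)

lemma cadj_mult: "cadj (A ** B) = cadj B ** cadj A"
  by (simp add: vec_eq_iff matrix_matrix_mult_def mult.commute)

lemma cadj_add: "cadj (A + B) = cadj A + cadj B"
  by (simp add: vec_eq_iff)

lemma cadj_mat_1[simp]: "cadj (mat 1) = mat 1"
  by (simp add: vec_eq_iff mat_def)

lemma det_cadj: "det (cadj A) = cnj (det A)"
proof -
  have "det (cadj A) = det (transpose (\<chi> i j. cnj (A $ i $ j)))"
    by (rule arg_cong[of _ _ det]) (simp add: vec_eq_iff transpose_def)
  also have "\<dots> = cnj (det A)"
    by (simp add: det_transpose) (simp add: det_def)
  finally show ?thesis .
qed

lemma cip_cadj: "cip u (A *v v) = cip (cadj A *v u) v"
proof -
  have "cip u (A *v v) = (\<Sum>i\<in>UNIV. \<Sum>j\<in>UNIV. cnj (u $ i) * (A $ i $ j * v $ j))"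
    by (simp add: cip_def matrix_vector_mult_def sum_distrib_left)
  also have "\<dots> = (\<Sum>j\<in>UNIV. \<Sum>i\<in>UNIV. cnj (u $ i) * (A $ i $ j * v $ j))"
    by (rule sum.swap)
  also have "\<dots> = cip (cadj A *v u) v"
    by (simp add: cip_def matrix_vector_mult_def sum_distrib_right sum_distrib_left ac_simps)
  finally show ?thesis .
qed

lemma cip_congruence: "cip v ((cadj G ** A ** G) *v v) = cip (G *v v) (A *v (G *v v))"
  by (simp add: cip_cadj[of "G *v v"] cip_cadj[of v] matrix_vector_mul_assoc cadj_mult matrix_mul_assoc)

lemma cip_self: "cip v v = of_real (\<Sum>i\<in>UNIV. (cmod (v $ i))\<^sup>2)"
  unfolding cip_def of_real_sum by (intro sum.cong refl) (metis complex_norm_square mult.commute)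

lemma cip_axis: "cip (axis i 1) (A *v axis j 1) = A $ i $ j"
proof -
  have "cip (axis i 1) (A *v axis j 1) = (\<Sum>k\<in>UNIV. if k = i then A $ k $ j else 0)"
    unfolding cip_def matrix_vector_mult_def axis_def
    by (intro sum.cong refl) (simp add: if_distrib if_distribR cong: if_cong)
  then show ?thesis by simp
qed

lemma pos_def_nth_cnj: "pos_def A \<Longrightarrow> cnj (A $ i $ j) = A $ j $ i"
  unfolding pos_def_def vec_eq_iff by (metis cadj_nth)

lemma pos_def_diag:
  assumes "pos_def A"
  shows "A $ i $ i = of_real (Re (A $ i $ i))" "0 < Re (A $ i $ i)"
proof -
  show "A $ i $ i = of_real (Re (A $ i $ i))"
    using pos_def_nth_cnj[OF assms, of i i] by (simp add: complex_eq_iff)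
  have "0 < Re (cip (axis i 1) (A *v axis i 1))"
    using assms by (auto simp: pos_def_def axis_eq_0_iff)
  then show "0 < Re (A $ i $ i)" by (simp add: cip_axis)
qed

lemma pos_def_congruence:
  assumes "pos_def A" "invertible G"
  shows "pos_def (cadj G ** A ** G)"
proof -
  have "G *v v \<noteq> 0" if "v \<noteq> 0" for v
    using assms(2) that by (metis invertible_def matrix_vector_mul_assoc matrix_vector_mul_lid matrix_vector_mult_0_right)
  then show ?thesis
    using assms(1) unfolding pos_def_def cip_congruence
    by (auto simp: cadj_mult matrix_mul_assoc)
qed

lemma pos_def_invertible:
  assumes "pos_def A" shows "invertible A"
proof -
  have "A *v v = 0 \<Longrightarrow> v = 0" for v
    using assms by (auto simp: pos_def_def cip_def)
  then show ?thesis
    using invertible_left_inverse matrix_left_invertible_ker by blast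
qed

text \<open>One step of the Hermitian LDL decomposition: it clears row and column \<^term>\<open>i\<close> of \<^term>\<open>A\<close>.\<close>

definition pivot :: "complex^'n^'n \<Rightarrow> 'n \<Rightarrow> complex^'n^'n" where
  "pivot A i = (\<chi> r j. if r = i then (if j = i then of_real (1 / sqrt (Re (A $ i $ i))) else - A $ i $ j / A $ i $ i)
     else if r = j then 1 else 0)"

text \<open>The transpose is the identity with one column replaced, so Cramer's lemma reads the
  determinant off the diagonal entry.\<close>

lemma det_pivot:
  fixes A :: "complex^'n^'n"
  shows "det (pivot A i) = of_real (1 / sqrt (Re (A $ i $ i)))"
proof -
  define v where "v = (\<chi> j. pivot A i $ i $ j)"
  have "transpose (pivot A i) = (\<chi> r j. if j = i then (mat 1 *v v) $ r else mat 1 $ r $ j)"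
    unfolding matrix_vector_mul_lid by (auto simp: vec_eq_iff transpose_def pivot_def v_def mat_def)
  from arg_cong[OF this, of det] have "det (pivot A i) = v $ i * det (mat 1 :: complex^'n^'n)"
    unfolding cramer_lemma det_transpose .
  then show ?thesis by (simp add: v_def pivot_def)
qed

text \<open>Only coordinate \<open>i\<close> moves: it is scaled by a positive constant and shifted
  by a function of the other coordinates. This is the shape of the one-coordinate substitution used
  for the Gaussian integral.\<close>

lemma pivot_mult_nth: "(pivot A i *v v) $ r =
  (if r = i then of_real (1 / sqrt (Re (A $ i $ i))) * v $ i - (\<Sum>j\<in>UNIV - {i}. A $ i $ j / A $ i $ i * v $ j) else v $ r)"
proof (cases "r = i")
  case True
  have "(pivot A i *v v) $ i = (\<Sum>j\<in>insert i (UNIV - {i}). pivot A i $ i $ j * v $ j)"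
    by (simp add: matrix_vector_mult_def insert_UNIV)
  also have "\<dots> = pivot A i $ i $ i * v $ i + (\<Sum>j\<in>UNIV - {i}. - (A $ i $ j / A $ i $ i * v $ j))"
    by (subst sum.insert) (auto intro!: sum.cong simp: pivot_def)
  finally show ?thesis using True by (simp add: pivot_def sum_negf)
next
  case False
  then have "(pivot A i *v v) $ r = (\<Sum>j\<in>UNIV. if j = r then v $ j else 0)"
    unfolding matrix_vector_mult_def vec_lambda_beta
    by (intro sum.cong refl) (auto simp: pivot_def)
  then show ?thesis using False by simp
qed

text \<open>Right multiplication by the pivot subtracts from each other column the multiple of
  column \<open>i\<close> that cancels its entry in row \<open>i\<close>. Column \<open>i\<close> of
  the pivot is a multiple of a unit vector, so left multiplication by its adjoint merely rescales
  row \<open>i\<close>; the two factors \<open>1 / sqrt (Re (A $ i $ i))\<close> then turn the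
  diagonal entry into 1.\<close>

lemma pivot_row:
  assumes "pos_def A"
  shows "(cadj (pivot A i) ** A ** pivot A i) $ i $ j = mat 1 $ i $ j"
proof -
  let ?c = "of_real (1 / sqrt (Re (A $ i $ i))) :: complex"
  note d = pos_def_diag[OF assms, of i]
  have Aii: "A $ i $ i \<noteq> 0" using d by (metis less_irrefl zero_complex.simps(1))
  have cc: "?c * (?c * A $ i $ i) = 1"
    by (subst d(1), subst of_real_mult[symmetric], subst of_real_mult[symmetric])
       (use d(2) in \<open>simp add: field_simps flip: power2_eq_square\<close>)
  have AG: "(A ** pivot A i) $ i $ j = (if j = i then ?c * A $ i $ i else 0)"
  proof -
    have "(A ** pivot A i) $ i $ j = (\<Sum>k\<in>insert i (UNIV - {i}). A $ i $ k * pivot A i $ k $ j)"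
      by (simp add: matrix_matrix_mult_def insert_UNIV)
    also have "\<dots> = A $ i $ i * pivot A i $ i $ j + (\<Sum>k\<in>UNIV - {i}. if k = j then A $ i $ j else 0)"
      by (subst sum.insert) (simp, simp, intro arg_cong2[where f="(+)"] sum.cong refl, auto simp: pivot_def)
    finally show ?thesis using Aii by (simp add: pivot_def)
  qed
  have "(cadj (pivot A i) ** (A ** pivot A i)) $ i $ j =
    (\<Sum>k\<in>UNIV. if k = i then ?c * (A ** pivot A i) $ i $ j else 0)"
    unfolding matrix_matrix_mult_def[of "cadj _"] vec_lambda_beta
    by (intro sum.cong refl) (simp add: pivot_def)
  also have "\<dots> = mat 1 $ i $ j"
    unfolding AG using cc by (cases "j = i") (simp_all add: mat_def del: of_real_divide of_real_1)
  finally show ?thesis by (simp add: matrix_mul_assoc)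
qed

text \<open>Progress is never undone: if row \<open>l\<close> is already a unit vector, the
  Hermitian symmetry gives \<open>A $ i $ l = 0\<close>, so the pivot at \<open>i\<close> leaves it
  alone.\<close>

lemma pivot_other_row:
  assumes A: "pos_def A" and l: "\<And>j. A $ l $ j = mat 1 $ l $ j" "l \<noteq> i"
  shows "(cadj (pivot A i) ** A ** pivot A i) $ l $ j = mat 1 $ l $ j"
proof -
  have Ail: "A $ i $ l = 0"
    using pos_def_nth_cnj[OF A, of l i] l by (simp add: mat_def)
  have AG: "(A ** pivot A i) $ l $ j = pivot A i $ l $ j"
  proof -
    have "(A ** pivot A i) $ l $ j = (\<Sum>k\<in>UNIV. if k = l then pivot A i $ l $ j else 0)"
      unfolding matrix_matrix_mult_def vec_lambda_beta
      by (intro sum.cong refl) (auto simp: l mat_def)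
    then show ?thesis by simp
  qed
  have "(cadj (pivot A i) ** (A ** pivot A i)) $ l $ j =
    (\<Sum>k\<in>UNIV. if k = l then (A ** pivot A i) $ l $ j else 0)"
    unfolding matrix_matrix_mult_def[of "cadj _"] vec_lambda_beta
    by (intro sum.cong refl) (use l(2) Ail in \<open>auto simp: pivot_def\<close>)
  also have "\<dots> = mat 1 $ l $ j"
    using l(2) by (simp add: AG) (simp add: pivot_def mat_def)
  finally show ?thesis by (simp add: matrix_mul_assoc)
qed

lemma borel_measurable_vec_nth[measurable (raw)]:
  fixes f :: "'a \<Rightarrow> 'b::euclidean_space^'n"
  shows "f \<in> borel_measurable M \<Longrightarrow> (\<lambda>x. f x $ i) \<in> borel_measurable M"
  by (erule measurable_compose) (intro borel_measurable_continuous_onI continuous_intros)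

section \<open>Second-moment matrices as expectations of rank-one matrices
  \<open>u v^H\<close>\<close>

definition outer :: "complex^'m \<Rightarrow> complex^'n \<Rightarrow> complex^'n^'m" where
  "outer u v = (\<chi> i j. u $ i * cnj (v $ j))"

lemma outer_add: "outer (u + u') v = outer u v + outer u' v" "outer u (v + v') = outer u v + outer u v'"
  by (simp_all add: outer_def vec_eq_iff algebra_simps)

lemma outer_mult_left: "outer (A *v u) v = A ** outer u v"
  by (simp add: outer_def vec_eq_iff matrix_vector_mult_def matrix_matrix_mult_def sum_distrib_right mult.assoc)

lemma cadj_outer: "cadj (outer u v) = outer v u"
  by (simp add: outer_def vec_eq_iff mult.commute)

lemma outer_mult_right: "outer u (A *v v) = outer u v ** cadj A"
  by (metis cadj_cadj cadj_mult cadj_outer outer_mult_left)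

text \<open>This makes a quadratic form linear in \<open>outer v v\<close>, so that its expectation
  depends on the second-moment matrix alone.\<close>

lemma cip_eq_trace: "cip v (A *v v) = trace (A ** outer v v)"
  by (simp add: cip_def trace_def outer_def matrix_vector_mult_def matrix_matrix_mult_def sum_distrib_left ac_simps)

lemma cip_outer: "cip v (outer w w *v v) = of_real ((cmod (cip v w))\<^sup>2)"
proof -
  have "cip v (outer w w *v v) = cip v w * cnj (cip v w)"
    by (simp add: cip_def outer_def matrix_vector_mult_def sum_distrib_left sum_distrib_right ac_simps)
  then show ?thesis by (metis complex_norm_square)
qed

lemma matrix_mul_distribs:
  fixes A :: "'a::comm_ring_1^'n^'m"
  shows "A ** (B - C) = A ** B - A ** C" "(A + A') ** B = A ** B + A' ** B" "(A - A') ** B = A ** B - A' ** B"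
  by (simp_all add: vec_eq_iff matrix_matrix_mult_def sum_subtractf sum.distrib algebra_simps)

lemma matrix_mul_uminus: "(- A) ** B = - (A ** B)" "A ** (- B) = - (A ** B)"
  for A :: "'a::comm_ring_1^'n^'m"
  by (simp_all add: vec_eq_iff matrix_matrix_mult_def sum_negf)

lemma cadj_uminus: "cadj (- A) = - cadj A"
  by (simp add: vec_eq_iff)

lemma bounded_linear_matrix_mult_left: "bounded_linear (\<lambda>B :: complex^'k^'n. (A :: complex^'n^'m) ** B)"
  unfolding linear_conv_bounded_linear[symmetric]
  by (rule linearI) (simp_all add: vec_eq_iff matrix_matrix_mult_def scaleR_sum_right sum.distrib algebra_simps)

lemma bounded_linear_matrix_mult_right: "bounded_linear (\<lambda>A :: complex^'n^'m. A ** (B :: complex^'k^'n))"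
  unfolding linear_conv_bounded_linear[symmetric]
  by (rule linearI) (simp_all add: vec_eq_iff matrix_matrix_mult_def scaleR_sum_right sum.distrib algebra_simps)

lemma bounded_linear_cadj: "bounded_linear (cadj :: complex^'n^'m \<Rightarrow> _)"
  unfolding linear_conv_bounded_linear[symmetric]
  by (rule linearI) (simp_all add: vec_eq_iff)

lemma bounded_linear_trace: "bounded_linear (trace :: complex^'n^'n \<Rightarrow> complex)"
  unfolding linear_conv_bounded_linear[symmetric]
  by (rule linearI) (simp_all add: trace_def sum.distrib scaleR_sum_right)

lemma bounded_linear_cip_mult: "bounded_linear (\<lambda>A. cip u (A *v v))"
  unfolding linear_conv_bounded_linear[symmetric]
  by (rule linearI)
    (simp_all add: cip_def matrix_vector_mult_def sum.distrib scaleR_sum_right[symmetric] algebra_simps)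

text \<open>Expand the outer product bilinearly; the fourth block, with \<open>u\<close> and
  \<open>v\<close> exchanged, is the adjoint of the third hypothesis-free cross moment
  \<open>V\<close>. The two uses are the residual \<open>s - E X\<close> and the estimation error
  \<open>X - L s\<close>.\<close>

lemma has_bochner_integral_outer_affine:
  fixes u :: "'a \<Rightarrow> complex^'n" and v :: "'a \<Rightarrow> complex^'m" and B :: "complex^'n^'k" and C :: "complex^'m^'k"
  assumes "has_bochner_integral M (\<lambda>\<omega>. outer (u \<omega>) (u \<omega>)) U"
    and "has_bochner_integral M (\<lambda>\<omega>. outer (v \<omega>) (u \<omega>)) V"
    and "has_bochner_integral M (\<lambda>\<omega>. outer (v \<omega>) (v \<omega>)) R"
  shows "has_bochner_integral M (\<lambda>\<omega>. outer (B *v u \<omega> + C *v v \<omega>) (B *v u \<omega> + C *v v \<omega>))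
    (B ** U ** cadj B + C ** V ** cadj B + B ** cadj V ** cadj C + C ** R ** cadj C)"
proof -
  have uv: "has_bochner_integral M (\<lambda>\<omega>. outer (u \<omega>) (v \<omega>)) (cadj V)"
    using has_bochner_integral_bounded_linear[OF bounded_linear_cadj assms(2)] by (simp add: cadj_outer)
  note mult = has_bochner_integral_bounded_linear[OF bounded_linear_matrix_mult_right
      has_bochner_integral_bounded_linear[OF bounded_linear_matrix_mult_left]]
  have "outer (B *v u \<omega> + C *v v \<omega>) (B *v u \<omega> + C *v v \<omega>) =
     B ** outer (u \<omega>) (u \<omega>) ** cadj B + C ** outer (v \<omega>) (u \<omega>) ** cadj B +
     B ** outer (u \<omega>) (v \<omega>) ** cadj C + C ** outer (v \<omega>) (v \<omega>) ** cadj C" for \<omega>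
    by (simp add: outer_add outer_mult_left outer_mult_right matrix_mul_assoc matrix_mul_distribs)
  then show ?thesis
    by (simp only:) (intro has_bochner_integral_add mult assms uv)
qed

text \<open>The form of \<open>R\<close> at \<open>v\<close> is the expectation of the nonnegative
  variable \<open>(cmod (cip v (w \<omega>)))^2\<close>.\<close>

lemma has_bochner_integral_outer_self:
  assumes "has_bochner_integral M (\<lambda>\<omega>. outer (w \<omega>) (w \<omega>)) R"
  shows "cadj R = R" "0 \<le> Re (cip v (R *v v))"
proof -
  have "has_bochner_integral M (\<lambda>\<omega>. outer (w \<omega>) (w \<omega>)) (cadj R)"
    using has_bochner_integral_bounded_linear[OF bounded_linear_cadj assms] by (simp add: cadj_outer)
  then show "cadj R = R"
    using assms by (metis has_bochner_integral_eq)
  have "has_bochner_integral M (\<lambda>\<omega>. Re (cip v (outer (w \<omega>) (w \<omega>) *v v))) (Re (cip v (R *v v)))"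
    by (intro has_bochner_integral_bounded_linear[OF bounded_linear_Re]
        has_bochner_integral_bounded_linear[OF bounded_linear_cip_mult] assms)
  then have "has_bochner_integral M (\<lambda>\<omega>. (cmod (cip v (w \<omega>)))\<^sup>2) (Re (cip v (R *v v)))"
    by (simp add: cip_outer del: of_real_power)
  then show "0 \<le> Re (cip v (R *v v))"
    by (subst has_bochner_integral_integral_eq[symmetric]) auto
qed

lemma matrix_inv_mult:
  fixes A :: "'a::semiring_1^'n^'n"
  assumes "invertible A"
  shows "A ** matrix_inv A = mat 1" "matrix_inv A ** A = mat 1"
  using someI_ex[OF assms[unfolded invertible_def]] by (simp_all add: matrix_inv_def)

lemma cadj_matrix_inv:
  assumes "cadj A = A" "invertible A"
  shows "cadj (matrix_inv A) = matrix_inv A"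
proof -
  have "cadj (matrix_inv A) ** A = mat 1"
    using arg_cong[OF matrix_inv_mult(1)[OF assms(2)], of cadj] assms(1) by (simp add: cadj_mult)
  then show ?thesis
    using matrix_inv_mult(1)[OF assms(2)] by (metis matrix_mul_assoc matrix_mul_lid matrix_mul_rid)
qed

text \<open>Writing \<open>w\<close> for the image of \<open>E *v v\<close> under the inverse of
  \<Psi> turns the second term into the form of \<Psi> itself at \<open>w\<close>, which is
  nonnegative; strict positivity comes from the identity.\<close>

lemma pos_def_mat_1_add:
  assumes Psi: "cadj \<Psi> = \<Psi>" "\<And>v. 0 \<le> Re (cip v (\<Psi> *v v))" "invertible \<Psi>"
  shows "pos_def (mat 1 + cadj E ** matrix_inv \<Psi> ** E)"
  unfolding pos_def_def
proof (intro conjI allI impI)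
  show "cadj (mat 1 + cadj E ** matrix_inv \<Psi> ** E) = mat 1 + cadj E ** matrix_inv \<Psi> ** E"
    by (simp add: cadj_add cadj_mult cadj_matrix_inv[OF Psi(1,3)] matrix_mul_assoc)
  fix v :: "complex^'b" assume "v \<noteq> 0"
  then obtain j where "v $ j \<noteq> 0" by (auto simp: vec_eq_iff)
  then have v: "0 < Re (cip v v)"
    unfolding cip_self Re_complex_of_real by (intro sum_pos2[of _ j]) auto
  define w where "w = matrix_inv \<Psi> *v (E *v v)"
  have \<Psi>w: "\<Psi> *v w = E *v v"
    by (simp add: w_def matrix_vector_mul_assoc matrix_mul_assoc matrix_inv_mult[OF Psi(3)])
  have "cip v ((cadj E ** matrix_inv \<Psi> ** E) *v v) = cip (\<Psi> *v w) w"
    unfolding cip_congruence \<Psi>w by (simp add: w_def)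
  also have "\<dots> = cip w (\<Psi> *v w)"
    by (simp add: cip_cadj Psi(1))
  finally show "0 < Re (cip v ((mat 1 + cadj E ** matrix_inv \<Psi> ** E) *v v))"
    using v Psi(2)[of w] by (simp add: matrix_vector_mult_add_rdistrib) (simp add: cip_def algebra_simps sum.distrib)
qed

subsection \<open>Complex Gaussian integrals\<close>

lemma sets_complex_normal[simp, measurable_cong]: "sets (complex_normal v) = sets borel"
  by (simp add: complex_normal_def)

lemma space_complex_normal[simp]: "space (complex_normal v) = UNIV"
  by (simp add: complex_normal_def)

lemma borel_measurable_Complex[measurable]: "(\<lambda>(a, b). Complex a b) \<in> borel_measurable (borel \<Otimes>\<^sub>M borel)"
  unfolding Complex_eq case_prod_beta by measurable

lemma prob_space_complex_normal: "0 < v \<Longrightarrow> prob_space (complex_normal v)"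
proof -
  assume v: "0 < v"
  interpret N: prob_space "density lborel (normal_density 0 (sqrt (v / 2)))"
    by (rule prob_space_normal_density) (use v in simp)
  interpret pair_prob_space "density lborel (normal_density 0 (sqrt (v / 2)))"
    "density lborel (normal_density 0 (sqrt (v / 2)))" by standard
  show ?thesis unfolding complex_normal_def by (rule prob_space_distr) measurable
qed

lemma nn_integral_complex_normal:
  assumes v: "0 < v" and [measurable]: "f \<in> borel_measurable borel"
  shows "(\<integral>\<^sup>+z. f z \<partial>complex_normal v) =
    (\<integral>\<^sup>+a. \<integral>\<^sup>+b. ennreal (normal_density 0 (sqrt (v / 2)) a * normal_density 0 (sqrt (v / 2)) b)
      * f (Complex a b) \<partial>lborel \<partial>lborel)"
proof -
  let ?N = "density lborel (normal_density 0 (sqrt (v / 2)))"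
  interpret N: prob_space ?N
    by (rule prob_space_normal_density) (use v in simp)
  have [measurable]: "(\<lambda>b. f (Complex a b)) \<in> borel_measurable borel" for a
    unfolding Complex_eq by measurable
  have "(\<integral>\<^sup>+z. f z \<partial>complex_normal v) = (\<integral>\<^sup>+x. f (case x of (a, b) \<Rightarrow> Complex a b) \<partial>(?N \<Otimes>\<^sub>M ?N))"
    unfolding complex_normal_def by (rule nn_integral_distr) measurable
  also have "\<dots> = (\<integral>\<^sup>+a. \<integral>\<^sup>+b. f (Complex a b) \<partial>?N \<partial>?N)"
    by (subst N.nn_integral_fst[symmetric]) (auto simp: Complex_eq)
  also have "\<dots> = (\<integral>\<^sup>+a. ennreal (normal_density 0 (sqrt (v / 2)) a) *
     (\<integral>\<^sup>+b. f (Complex a b) \<partial>?N) \<partial>lborel)"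
    by (subst nn_integral_density) (auto simp: Complex_eq)
  also have "\<dots> = (\<integral>\<^sup>+a. ennreal (normal_density 0 (sqrt (v / 2)) a) *
     (\<integral>\<^sup>+b. ennreal (normal_density 0 (sqrt (v / 2)) b) * f (Complex a b) \<partial>lborel) \<partial>lborel)"
    by (subst nn_integral_density) (auto simp: Complex_eq)
  also have "\<dots> = (\<integral>\<^sup>+a. \<integral>\<^sup>+b. ennreal (normal_density 0 (sqrt (v / 2)) a * normal_density 0 (sqrt (v / 2)) b)
      * f (Complex a b) \<partial>lborel \<partial>lborel)"
    by (subst nn_integral_cmult[symmetric]) (auto simp: ennreal_mult ac_simps Complex_eq)
  finally show ?thesis .
qed

text \<open>The standard complex normal law has density \<open>exp (- (cmod z)^2) / pi\<close> on
  the plane; the weight cancels the exponential and leaves Lebesgue measure divided by pi.\<close>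

lemma nn_integral_complex_normal_exp:
  assumes [measurable]: "f \<in> borel_measurable borel"
  shows "(\<integral>\<^sup>+z. f z * ennreal (exp ((cmod z)\<^sup>2)) \<partial>complex_normal 1) =
    (\<integral>\<^sup>+a. \<integral>\<^sup>+b. ennreal (1 / pi) * f (Complex a b) \<partial>lborel \<partial>lborel)"
proof -
  have eq: "normal_density 0 (sqrt (1 / 2)) a * normal_density 0 (sqrt (1 / 2)) b * exp ((cmod (Complex a b))\<^sup>2)
    = 1 / pi" for a b
    by (simp add: normal_density_def cmod_def power2_eq_square[symmetric] exp_minus exp_add divide_simps
       flip: exp_add power2_eq_square real_sqrt_mult) (simp add: exp_minus exp_add field_simps)
  have eq': "ennreal (normal_density 0 (sqrt (1 / 2)) a * normal_density 0 (sqrt (1 / 2)) b) *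
      (f (Complex a b) * ennreal (exp ((cmod (Complex a b))\<^sup>2))) = ennreal (1 / pi) * f (Complex a b)" for a b
    unfolding eq[symmetric, of a b] by (subst ennreal_mult[of _ "exp _"]) (auto simp: ac_simps)
  show ?thesis
    by (subst nn_integral_complex_normal) (auto intro!: nn_integral_cong simp: eq')
qed

text \<open>With the weight the measure is a multiple of planar Lebesgue measure, hence translation
  invariant; scaling by \<open>a\<close> costs one factor \<open>a\<close> for each of the real and
  imaginary parts.\<close>

lemma nn_integral_complex_normal_affine:
  assumes [measurable]: "f \<in> borel_measurable borel" and a: "0 < a"
  shows "(\<integral>\<^sup>+z. f z * ennreal (exp ((cmod z)\<^sup>2)) \<partial>complex_normal 1) =
    ennreal (a\<^sup>2) * (\<integral>\<^sup>+z. f (of_real a * z + h) * ennreal (exp ((cmod z)\<^sup>2)) \<partial>complex_normal 1)"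
proof -
  have [measurable]: "(\<lambda>x. f (Complex (p x) (q x))) \<in> borel_measurable M"
    if "p \<in> borel_measurable M" "q \<in> borel_measurable M" for p q and M :: "'x measure"
    using that unfolding Complex_eq by measurable
  have C: "of_real a * Complex u v + h = Complex (Re h + a * u) (Im h + a * v)" for u v
    by (simp add: complex_eq_iff)
  have "(\<integral>\<^sup>+u. \<integral>\<^sup>+v. ennreal (1 / pi) * f (Complex u v) \<partial>lborel \<partial>lborel) =
     (\<integral>\<^sup>+u. \<integral>\<^sup>+v. ennreal (1 / pi) * ennreal a * f (Complex u (Im h + a * v)) \<partial>lborel \<partial>lborel)"
    by (subst nn_integral_real_affine[where c=a and t="Im h"])
      (use a in \<open>auto simp: nn_integral_cmult ac_simps\<close>)
  also have "\<dots> = ennreal a * (\<integral>\<^sup>+u. \<integral>\<^sup>+v. ennreal (1 / pi) * ennreal a * f (Complex (Re h + a * u) (Im h + a * v)) \<partial>lborel \<partial>lborel)"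
    by (subst nn_integral_real_affine[where c=a and t="Re h"]) (use a in auto)
  also have "\<dots> = ennreal (a\<^sup>2) * (\<integral>\<^sup>+u. \<integral>\<^sup>+v. ennreal (1 / pi) * f (of_real a * Complex u v + h) \<partial>lborel \<partial>lborel)"
    unfolding C using a by (simp add: nn_integral_cmult power2_eq_square ennreal_mult ac_simps)
  finally show ?thesis
    by (simp add: nn_integral_complex_normal_exp)
qed

text \<open>Integrate over coordinate \<open>i\<close> innermost. As \<open>h\<close> ignores that
  coordinate, it is a constant shift there, and the planar substitution applies for each choice of
  the other coordinates.\<close>

lemma nn_integral_PiM_complex_normal_affine:
  fixes i :: "'n::finite" and F :: "('n \<Rightarrow> complex) \<Rightarrow> ennreal" and h :: "('n \<Rightarrow> complex) \<Rightarrow> complex"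
  defines "\<gamma> \<equiv> \<Pi>\<^sub>M j\<in>(UNIV :: 'n set). complex_normal 1"
  assumes [measurable]: "F \<in> borel_measurable \<gamma>" "h \<in> borel_measurable \<gamma>"
    and h: "\<And>x y. h (x(i := y)) = h x" and a: "0 < a"
  shows "(\<integral>\<^sup>+x. F x * ennreal (exp (\<Sum>j\<in>UNIV. (cmod (x j))\<^sup>2)) \<partial>\<gamma>) =
    ennreal (a\<^sup>2) * (\<integral>\<^sup>+x. F (x(i := of_real a * x i + h x)) * ennreal (exp (\<Sum>j\<in>UNIV. (cmod (x j))\<^sup>2)) \<partial>\<gamma>)"
proof -
  let ?J = "UNIV - {i}" and ?g = "\<lambda>_::'n. complex_normal 1"
  let ?\<gamma>' = "\<Pi>\<^sub>M j\<in>?J. complex_normal 1"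
  interpret N: prob_space "complex_normal 1" by (rule prob_space_complex_normal) simp
  interpret product_sigma_finite ?g by standard
  have ins: "insert i ?J = UNIV" by auto
  have upd: "(\<lambda>y. x(i := q y)) \<in> measurable borel \<gamma>"
    if "x \<in> space ?\<gamma>'" "q \<in> borel_measurable borel" for x and q :: "complex \<Rightarrow> complex"
    unfolding \<gamma>_def by (rule measurable_fun_upd[where J="?J"]) (use that in auto)
  have iterate: "(\<integral>\<^sup>+x. G x \<partial>\<gamma>) = (\<integral>\<^sup>+x. \<integral>\<^sup>+y. G (x(i := y)) \<partial>complex_normal 1 \<partial>?\<gamma>')"
    if "G \<in> borel_measurable \<gamma>" for G
    using product_nn_integral_insert[of ?J i G] that by (simp add: ins \<gamma>_def)
  have split: "ennreal (exp (\<Sum>j\<in>UNIV. (cmod ((x(i := y)) j))\<^sup>2)) =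
    ennreal (exp (\<Sum>j\<in>?J. (cmod (x j))\<^sup>2)) * ennreal (exp ((cmod y)\<^sup>2))" for x y
    by (subst ins[symmetric], subst sum.insert) (auto simp: exp_add ennreal_mult[symmetric] mult.commute)
  have inner: "(\<integral>\<^sup>+y. F (x(i := y)) * ennreal (exp (\<Sum>j\<in>UNIV. (cmod ((x(i := y)) j))\<^sup>2)) \<partial>complex_normal 1) =
    ennreal (a\<^sup>2) * (\<integral>\<^sup>+y. F (x(i := of_real a * y + h x)) *
       ennreal (exp (\<Sum>j\<in>UNIV. (cmod ((x(i := y)) j))\<^sup>2)) \<partial>complex_normal 1)"
    if x: "x \<in> space ?\<gamma>'" for x
  proof -
    have "(\<lambda>y. F (x(i := y))) \<in> borel_measurable borel"
      by (rule measurable_compose[OF upd[OF x] assms(2)]) simp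
    then have "(\<lambda>y. F (x(i := y)) * ennreal (exp (\<Sum>j\<in>?J. (cmod (x j))\<^sup>2))) \<in> borel_measurable borel"
      by measurable
    from nn_integral_complex_normal_affine[OF this a, of "h x"] show ?thesis
      unfolding split by (simp add: mult.assoc)
  qed
  have [measurable]: "(\<lambda>x. x(i := of_real a * x i + h x)) \<in> measurable \<gamma> \<gamma>"
    unfolding \<gamma>_def
  proof (rule measurable_PiM_single')
    fix j :: 'n
    have "(\<lambda>x. if j = i then of_real a * x i + h x else x j) \<in> borel_measurable \<gamma>"
      unfolding \<gamma>_def using assms(3)[unfolded \<gamma>_def] by measurable
    then show "(\<lambda>x. (x(i := of_real a * x i + h x)) j) \<in> measurable (PiM UNIV ?g) (?g j)"
      by (simp add: \<gamma>_def fun_upd_def cong: measurable_cong_sets)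
  qed (auto simp: space_PiM)
  have [measurable]: "(\<lambda>x. x j) \<in> borel_measurable \<gamma>" for j
    unfolding \<gamma>_def measurable_cong_sets[OF refl sets_complex_normal[symmetric, of 1]]
    by (rule measurable_component_singleton) simp
  have "(\<integral>\<^sup>+x. F x * ennreal (exp (\<Sum>j\<in>UNIV. (cmod (x j))\<^sup>2)) \<partial>\<gamma>) =
     (\<integral>\<^sup>+x. ennreal (a\<^sup>2) * (\<integral>\<^sup>+y. F (x(i := of_real a * y + h x)) *
       ennreal (exp (\<Sum>j\<in>UNIV. (cmod ((x(i := y)) j))\<^sup>2)) \<partial>complex_normal 1) \<partial>?\<gamma>')"
    by (subst nn_integral_cong[OF inner, symmetric], assumption, rule iterate) measurable
  also have "\<dots> = (\<integral>\<^sup>+x. (\<integral>\<^sup>+y. ennreal (a\<^sup>2) * (F (x(i := of_real a * y + h x)) *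
       ennreal (exp (\<Sum>j\<in>UNIV. (cmod ((x(i := y)) j))\<^sup>2))) \<partial>complex_normal 1) \<partial>?\<gamma>')"
  proof (intro nn_integral_cong nn_integral_cmult[symmetric])
    fix x assume x: "x \<in> space ?\<gamma>'"
    have [measurable]: "(\<lambda>y. F (x(i := of_real a * y + h x))) \<in> borel_measurable borel"
      by (rule measurable_compose[OF upd[OF x] assms(2)]) measurable
    show "(\<lambda>y. F (x(i := of_real a * y + h x)) *
        ennreal (exp (\<Sum>j\<in>UNIV. (cmod ((x(i := y)) j))\<^sup>2))) \<in> borel_measurable (complex_normal 1)"
      unfolding split measurable_cong_sets[OF sets_complex_normal refl] by measurable
  qed
  also have "\<dots> = (\<integral>\<^sup>+x. ennreal (a\<^sup>2) * (F (x(i := of_real a * x i + h x)) *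
      ennreal (exp (\<Sum>j\<in>UNIV. (cmod (x j))\<^sup>2))) \<partial>\<gamma>)"
    by (subst iterate) (auto simp: h)
  finally show ?thesis
    by (simp add: nn_integral_cmult)
qed

lemma borel_measurable_vecI:
  fixes f :: "'a \<Rightarrow> 'b::euclidean_space^'n"
  assumes "\<And>i. (\<lambda>x. f x $ i) \<in> borel_measurable M"
  shows "f \<in> borel_measurable M"
proof (subst borel_measurable_euclidean_space, intro ballI)
  fix b :: "'b^'n" assume "b \<in> Basis"
  then obtain i u where b: "b = axis i u" by (auto simp: Basis_vec_def)
  show "(\<lambda>x. f x \<bullet> b) \<in> borel_measurable M"
    unfolding b inner_axis using assms by measurable
qed

lemma continuous_on_matrix_vector_mult[continuous_intros]:
  fixes A :: "complex^'n^'m"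
  shows "continuous_on X f \<Longrightarrow> continuous_on X (\<lambda>x. A *v f x)"
  unfolding matrix_vector_mult_def by (intro continuous_intros)

lemma continuous_on_cip[continuous_intros]:
  "continuous_on X f \<Longrightarrow> continuous_on X g \<Longrightarrow> continuous_on X (\<lambda>x. cip (f x) (g x))"
  unfolding cip_def by (intro continuous_intros)

text \<open>Gaussian elimination on \<^term>\<open>A\<close>, one coordinate at a time: each pivot step is an affine substitution
  in a single coordinate, so no multidimensional change of variables is needed.\<close>

lemma pos_def_gaussian_integral:
  fixes A :: "complex^'n^'n" and \<mu> :: "complex^'n"
  assumes "finite S" "pos_def A"
    and "\<And>i j. i \<notin> S \<Longrightarrow> A $ i $ j = mat 1 $ i $ j" "\<And>i. i \<notin> S \<Longrightarrow> \<mu> $ i = 0"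
  shows "det A = of_real (Re (det A)) \<and> 0 < Re (det A) \<and>
    ennreal (Re (det A)) * (\<integral>\<^sup>+x. ennreal (exp (- Re (cip (vec_lambda x - \<mu>) (A *v (vec_lambda x - \<mu>))))) *
      ennreal (exp (\<Sum>j\<in>UNIV. (cmod (x j))\<^sup>2)) \<partial>(\<Pi>\<^sub>M j\<in>(UNIV :: 'n set). complex_normal 1)) = 1"
  using assms
\<comment> \<open>\<open>S\<close> holds the coordinates still to be eliminated; outside it
  \<open>A\<close> is already the identity and the mean is zero. For \<open>S = UNIV\<close> these
  conditions are vacuous. Reality and positivity of the determinant travel along in the
  induction.\<close>
proof (induction S arbitrary: A \<mu> rule: finite_induct)
  case empty
  then have A: "A = mat 1" and \<mu>: "\<mu> = 0" by (auto simp: vec_eq_iff)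
  interpret N: prob_space "complex_normal 1" by (rule prob_space_complex_normal) simp
  interpret P: prob_space "\<Pi>\<^sub>M j\<in>(UNIV :: 'n set). complex_normal 1"
    by (rule prob_space_PiM) (rule N.prob_space_axioms)
  show ?case
    by (simp add: A \<mu> cip_self ennreal_mult[symmetric] exp_minus P.emeasure_space_1 del: of_real_sum)
next
  case (insert i S)
  note pd = \<open>pos_def A\<close>
  let ?\<gamma> = "\<Pi>\<^sub>M j\<in>(UNIV :: 'n set). complex_normal 1"
  define G where "G = pivot A i"
  define a where "a = 1 / sqrt (Re (A $ i $ i))"
  define A' where "A' = cadj G ** A ** G"
  define \<mu>' where "\<mu>' = (\<chi> j. if j = i then 0 else \<mu> $ j)"
  have a: "0 < a" using pos_def_diag(2)[OF pd] by (simp add: a_def)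
  have detG: "det G = of_real a" by (simp add: G_def a_def det_pivot)
  have invG: "invertible G" using a by (simp add: invertible_det_nz detG)
  have pd': "pos_def A'" unfolding A'_def by (rule pos_def_congruence[OF pd invG])
  have rows: "A' $ l $ j = mat 1 $ l $ j" if "l \<notin> S" for l j
    using that insert.prems(2) pivot_row[OF pd] pivot_other_row[OF pd]
    unfolding A'_def G_def by (cases "l = i") auto
  have \<mu>'0: "\<mu>' $ l = 0" if "l \<notin> S" for l
    using that insert.prems(3) by (auto simp: \<mu>'_def)
  note IH = insert.IH[OF pd' rows \<mu>'0]
  have detA': "det A' = of_real (a\<^sup>2) * det A"
    unfolding A'_def det_mul det_cadj detG by (simp add: power2_eq_square)
  have detA: "det A = of_real (Re (det A))"
    using IH a by (auto simp: detA' complex_eq_iff)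
  have ReA': "Re (det A') = a\<^sup>2 * Re (det A)"
    by (simp add: detA')
  have pos: "0 < Re (det A)"
    using IH a by (auto simp: ReA' zero_less_mult_iff)
  \<comment> \<open>Completing the square: with the other coordinates fixed, the quadratic form is
    smallest at \<open>x i = h x\<close>, the conditional mean of coordinate
    \<open>i\<close>.\<close>
  define h where "h x = \<mu> $ i - (\<Sum>j\<in>UNIV - {i}. A $ i $ j / A $ i $ i * (x j - \<mu> $ j))" for x :: "'n \<Rightarrow> complex"
  have vec: "(vec_lambda :: _ \<Rightarrow> complex^'n) \<in> borel_measurable ?\<gamma>"
    unfolding measurable_cong_sets[OF sets_PiM_cong[OF refl sets_complex_normal] refl]
    by (rule borel_measurable_vecI) simp
  \<comment> \<open>The shift \<open>h\<close> absorbs the mean in coordinate \<open>i\<close>,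
    which is why \<mu>' vanishes there and satisfies the induction hypothesis.\<close>
  have subst: "vec_lambda (x(i := of_real a * x i + h x)) - \<mu> = G *v (vec_lambda x - \<mu>')" for x
    by (auto simp: vec_eq_iff G_def pivot_mult_nth h_def \<mu>'_def a_def[symmetric] intro!: sum.cong)
  let ?F = "\<lambda>x. ennreal (exp (- Re (cip (vec_lambda x - \<mu>) (A *v (vec_lambda x - \<mu>)))))"
  have meas_F: "?F \<in> borel_measurable ?\<gamma>"
    by (rule measurable_compose[OF vec])
       (intro measurable_compose[OF _ measurable_ennreal] borel_measurable_continuous_onI continuous_intros)
  have "(\<lambda>v :: complex^'n. \<mu> $ i - (\<Sum>j\<in>UNIV - {i}. A $ i $ j / A $ i $ i * (v $ j - \<mu> $ j))) \<in> borel_measurable borel"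
    by (intro borel_measurable_continuous_onI continuous_intros)
  from measurable_compose[OF vec this] have meas_h: "h \<in> borel_measurable ?\<gamma>"
    by (simp add: h_def[abs_def])
  have "(\<integral>\<^sup>+x. ?F x * ennreal (exp (\<Sum>j\<in>UNIV. (cmod (x j))\<^sup>2)) \<partial>?\<gamma>) =
    ennreal (a\<^sup>2) * (\<integral>\<^sup>+x. ?F (x(i := of_real a * x i + h x)) * ennreal (exp (\<Sum>j\<in>UNIV. (cmod (x j))\<^sup>2)) \<partial>?\<gamma>)"
    by (rule nn_integral_PiM_complex_normal_affine) (use meas_F meas_h a in \<open>auto simp: h_def intro!: sum.cong\<close>)
  also have "\<dots> = ennreal (a\<^sup>2) * (\<integral>\<^sup>+x. ennreal (exp (- Re (cip (vec_lambda x - \<mu>') (A' *v (vec_lambda x - \<mu>'))))) *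
      ennreal (exp (\<Sum>j\<in>UNIV. (cmod (x j))\<^sup>2)) \<partial>?\<gamma>)"
    unfolding subst A'_def cip_congruence ..
  finally show ?case
    using IH detA pos a by (simp add: ReA' ennreal_mult ac_simps)
qed

subsection \<open>Lower bound on the mutual information\<close>

text \<open>With \<open>D\<close> the density of \<open>Q\<close>, apply
  \<open>ln t <= t - 1\<close> to \<open>t = g / D\<close> and integrate: the mean of
  \<open>g / D\<close> under \<open>Q\<close> is at most the integral of \<open>g\<close> under
  \<open>M\<close>, hence at most 1. So \<open>g\<close> can be any positive trial function and need
  not be the density of \<open>Q\<close>.\<close>

lemma (in prob_space) log_integral_le_KL_divergence:
  fixes g :: "'a \<Rightarrow> real"
  assumes b: "1 < b" and Q: "prob_space Q" and ac: "absolutely_continuous M Q" "sets Q = sets M"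
    and int: "integrable Q (entropy_density b M Q)"
    and g[measurable]: "g \<in> borel_measurable M" and g_pos: "\<And>x. 0 < g x"
    and g_le: "(\<integral>\<^sup>+x. ennreal (g x) \<partial>M) \<le> 1"
    and g_int: "integrable Q (\<lambda>x. ln (g x))"
  shows "(\<integral>x. ln (g x) \<partial>Q) / ln b \<le> KL_divergence b M Q"
proof -
  interpret Q: prob_space Q by fact
  from real_RN_deriv[OF Q.finite_measure_axioms ac] obtain D
    where D: "D \<in> borel_measurable M" "AE x in M. RN_deriv M Q x = ennreal (D x)"
      "AE x in Q. 0 < D x" "\<And>x. 0 \<le> D x"
    by this auto
  note [measurable] = D(1)
  have [measurable_cong]: "sets Q = sets M" by fact
  have "Q = density M (RN_deriv M Q)"
    using ac by (rule density_RN_deriv[symmetric])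
  also have "\<dots> = density M D"
    using D by (auto intro!: density_cong)
  finally have Q_eq: "Q = density M D" .
  have D_AE: "AE x in Q. RN_deriv M Q x = ennreal (D x)"
    using absolutely_continuous_AE[OF ac(2,1) D(2)] .
  have ed: "AE x in Q. entropy_density b M Q x = log b (D x)"
    using D_AE by eventually_elim (simp add: entropy_density_def D(4))
  have intD: "integrable Q (\<lambda>x. log b (D x))"
    by (rule integrable_cong_AE_imp[OF int]) (use ed in auto)
  have KL: "KL_divergence b M Q = (\<integral>x. log b (D x) \<partial>Q)"
    unfolding KL_divergence_def
    by (rule integral_cong_AE) (use ed measurable_entropy_density[of b M Q] in auto)
  have lnD: "integrable Q (\<lambda>x. ln (D x))"
    using integrable_mult_left[OF intD, of "ln b"] b by (simp add: log_def)
  have nn: "(\<integral>\<^sup>+x. ennreal (g x / D x) \<partial>Q) \<le> 1"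
  proof -
    have "(\<integral>\<^sup>+x. ennreal (g x / D x) \<partial>Q) = (\<integral>\<^sup>+x. ennreal (D x) * ennreal (g x / D x) \<partial>M)"
      unfolding Q_eq by (subst nn_integral_density) auto
    \<comment> \<open>An inequality only: points with \<open>D x = 0\<close> contribute nothing to
      the left side.\<close>
    also have "\<dots> \<le> (\<integral>\<^sup>+x. ennreal (g x) \<partial>M)"
    proof (intro nn_integral_mono)
      fix x
      show "ennreal (D x) * ennreal (g x / D x) \<le> ennreal (g x)"
        using D(4)[of x] g_pos[of x] by (cases "D x = 0") (auto simp: ennreal_mult[symmetric])
    qed
    finally show ?thesis using g_le by simp
  qed
  have int_q: "integrable Q (\<lambda>x. g x / D x)"
  proof (rule integrableI_bounded)
    have "(\<integral>\<^sup>+x. ennreal (norm (g x / D x)) \<partial>Q) = (\<integral>\<^sup>+x. ennreal (g x / D x) \<partial>Q)"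
      using D(4) g_pos by (intro nn_integral_cong) (auto simp: less_imp_le)
    then show "(\<integral>\<^sup>+x. ennreal (norm (g x / D x)) \<partial>Q) < \<infinity>"
      using nn by (auto simp: less_top[symmetric] top_unique)
  qed simp
  have q1: "(\<integral>x. g x / D x \<partial>Q) \<le> 1"
  proof -
    have "ennreal (\<integral>x. g x / D x \<partial>Q) \<le> ennreal 1"
      using nn int_q D(4) g_pos by (subst nn_integral_eq_integral[symmetric]) (auto simp: less_imp_le)
    then show ?thesis by (subst (asm) ennreal_le_iff) auto
  qed
  have "(\<integral>x. ln (g x) - ln (D x) \<partial>Q) \<le> (\<integral>x. g x / D x - 1 \<partial>Q)"
  proof (rule integral_mono_AE)
    show "AE x in Q. ln (g x) - ln (D x) \<le> g x / D x - 1"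
      using D(3)
    proof eventually_elim
      fix x assume "0 < D x"
      then show "ln (g x) - ln (D x) \<le> g x / D x - 1"
        using ln_le_minus_one[of "g x / D x"] g_pos[of x] by (simp add: ln_div)
    qed
  qed (use g_int lnD int_q in auto)
  also have "\<dots> \<le> 0" using q1 int_q by (simp add: Q.prob_space)
  finally have "(\<integral>x. ln (g x) \<partial>Q) \<le> (\<integral>x. ln (D x) \<partial>Q)"
    using g_int lnD by simp
  then show ?thesis
    unfolding KL using b lnD by (simp add: log_def divide_right_mono)
qed

text \<open>The candidate density is the posterior of \<^term>\<open>X\<close> in the jointly Gaussian model with the same
  second moments, relative to the law of \<^term>\<open>X\<close>: posterior mean \<^term>\<open>L *v s\<close> and covariance \<^term>\<open>matrix_inv A\<close>.\<close>

theorem (in prob_space) log_det_le_mutual_information_ext: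
  fixes X :: "'a \<Rightarrow> complex^'n" and Y s :: "'a \<Rightarrow> complex^'m" and E :: "complex^'n^'m" and \<Psi> :: "complex^'m^'m"
  assumes X_law: "distr M (\<Pi>\<^sub>M i\<in>(UNIV :: 'n set). borel) (\<lambda>\<omega> i. X \<omega> $ i) = (\<Pi>\<^sub>M i\<in>(UNIV :: 'n set). complex_normal 1)"
    and X[measurable]: "X \<in> borel_measurable M" and Y[measurable]: "Y \<in> borel_measurable M"
    and s: "\<And>\<omega>. \<omega> \<in> space M \<Longrightarrow> s \<omega> = c *\<^sub>R Y \<omega>"
    and XX: "has_bochner_integral M (\<lambda>\<omega>. outer (X \<omega>) (X \<omega>)) (mat 1)"
    and sX: "has_bochner_integral M (\<lambda>\<omega>. outer (s \<omega>) (X \<omega>)) E"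
    and ss: "has_bochner_integral M (\<lambda>\<omega>. outer (s \<omega>) (s \<omega>)) (\<Psi> + E ** cadj E)"
    and inv: "invertible \<Psi>"
  shows "ereal (log 2 (Re (det (mat 1 + cadj E ** matrix_inv \<Psi> ** E)))) \<le> mutual_information_ext M 2 borel borel X Y"
proof -
  define A where "A = mat 1 + cadj E ** matrix_inv \<Psi> ** E"
  define L where "L = matrix_inv A ** cadj E ** matrix_inv \<Psi>"
  \<comment> \<open>This is the residual \<open>s - E X\<close>; its covariance being \<Psi> is what
    supplies symmetry and semidefiniteness.\<close>
  have "has_bochner_integral M (\<lambda>\<omega>. outer ((- E) *v X \<omega> + mat 1 *v s \<omega>) ((- E) *v X \<omega> + mat 1 *v s \<omega>)) \<Psi>"
    using has_bochner_integral_outer_affine[OF XX sX ss, of "- E" "mat 1"]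
    by (simp add: cadj_uminus matrix_mul_uminus)
  note Psi = has_bochner_integral_outer_self[OF this]
  have A: "pos_def A" unfolding A_def by (rule pos_def_mat_1_add) (use Psi inv in auto)
  have cA: "cadj A = A" using A by (simp add: pos_def_def)
  have AL: "A ** L = cadj E ** matrix_inv \<Psi>"
    by (simp add: L_def matrix_mul_assoc matrix_inv_mult[OF pos_def_invertible[OF A]])
  \<comment> \<open>The error of the best linear estimate \<open>L *v s \<omega>\<close> of
    \<open>X \<omega>\<close>; \<open>C\<close> below is its covariance, to be identified as the
    inverse of \<open>A\<close>.\<close>
  define d where "d \<omega> = mat 1 *v X \<omega> + (- L) *v s \<omega>" for \<omega>
  define C where "C = mat 1 - L ** E - cadj E ** cadj L + L ** (\<Psi> + E ** cadj E) ** cadj L"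
  have dd: "has_bochner_integral M (\<lambda>\<omega>. outer (d \<omega>) (d \<omega>)) C"
    using has_bochner_integral_outer_affine[OF XX sX ss, of "mat 1" "- L"]
    by (simp add: cadj_uminus matrix_mul_uminus d_def C_def)
  have AC: "A ** C = mat 1"
  proof -
    have 1: "A ** (L ** E) = A - mat 1"
      by (simp add: matrix_mul_assoc AL) (simp add: A_def)
    \<comment> \<open>After cancelling \<open>A\<close> this is the normal equation
      \<open>L (\<Psi> + E E^H) = E^H\<close> of linear mean-square estimation. It makes the last
      two terms of \<open>A ** C\<close> cancel.\<close>
    have "A ** (L ** (\<Psi> + E ** cadj E)) = cadj E + (A - mat 1) ** cadj E"
      by (simp add: matrix_add_ldistrib matrix_mul_assoc AL matrix_mul_assoc[symmetric, of _ "matrix_inv \<Psi>" \<Psi>]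
          matrix_inv_mult[OF inv]) (simp add: A_def)
    then have 2: "A ** (L ** (\<Psi> + E ** cadj E)) = A ** cadj E"
      by (simp add: matrix_mul_distribs)
    have "A ** C = A - A ** (L ** E) - A ** (cadj E ** cadj L) + A ** (L ** (\<Psi> + E ** cadj E)) ** cadj L"
      unfolding C_def by (simp add: matrix_add_ldistrib matrix_mul_distribs matrix_mul_assoc)
    then show ?thesis unfolding 1 2 by (simp add: matrix_mul_assoc)
  qed
  define q where "q x y = Re (cip (x - L *v (c *\<^sub>R y)) (A *v (x - L *v (c *\<^sub>R y))))" for x y
  \<comment> \<open>Posterior density \<open>det A / pi^n * exp (- q x y)\<close> over prior density
    \<open>exp (- |x|^2) / pi^n\<close>; the powers of pi cancel.\<close>
  define g where "g = (\<lambda>(x, y). Re (det A) * exp (Re (cip x x) - q x y))"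
  interpret X: prob_space "distr M borel X" by (rule prob_space_distr) simp
  interpret Y: prob_space "distr M borel Y" by (rule prob_space_distr) simp
  interpret XY: pair_prob_space "distr M borel X" "distr M borel Y" ..
  let ?Pr = "distr M borel X \<Otimes>\<^sub>M distr M borel Y" and ?Q = "distr M (borel \<Otimes>\<^sub>M borel) (\<lambda>\<omega>. (X \<omega>, Y \<omega>))"
  note det = pos_def_gaussian_integral[OF finite A, of UNIV]
  have detA: "0 < Re (det A)" using det by simp
  have g_meas: "g \<in> borel_measurable (borel \<Otimes>\<^sub>M borel)"
    unfolding borel_prod g_def q_def case_prod_beta
    by (intro borel_measurable_continuous_onI continuous_intros)
  have vec: "(vec_lambda :: _ \<Rightarrow> complex^'n) \<in> borel_measurable (\<Pi>\<^sub>M i\<in>(UNIV :: 'n set). borel)"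
    by (rule borel_measurable_vecI) simp
  have X_law': "distr M borel X = distr (\<Pi>\<^sub>M i\<in>(UNIV :: 'n set). complex_normal 1) borel vec_lambda"
    unfolding X_law[symmetric]
    by (subst distr_distr[OF vec]) (auto intro!: measurable_PiM_single' distr_cong simp: comp_def)
  have meas: "(\<lambda>x. ennreal (exp (- q (vec_lambda x) y)) * ennreal (exp (\<Sum>j\<in>UNIV. (cmod (x j))\<^sup>2)))
      \<in> borel_measurable (\<Pi>\<^sub>M i\<in>(UNIV :: 'n set). complex_normal 1)" for y
  proof -
    have "(\<lambda>v. ennreal (exp (- q v y)) * ennreal (exp (\<Sum>j\<in>UNIV. (cmod (v $ j))\<^sup>2))) \<in> borel_measurable borel"
      unfolding q_def ennreal_mult[OF exp_ge_zero exp_ge_zero, symmetric]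
      by (intro measurable_compose[OF _ measurable_ennreal] borel_measurable_continuous_onI continuous_intros)
    from measurable_compose[OF vec this] show ?thesis
      by (simp cong: measurable_cong_sets sets_PiM_cong)
  qed
  \<comment> \<open>For a fixed \<open>y\<close> the shift \<open>L *v (c *\<^sub>R y)\<close> is
    just the mean in the Gaussian integral, so only the law of \<open>X\<close> enters.\<close>
  have g1: "(\<integral>\<^sup>+x. ennreal (g (x, y)) \<partial>distr M borel X) = 1" for y
  proof -
    have "(\<integral>\<^sup>+x. ennreal (g (x, y)) \<partial>distr M borel X) =
      (\<integral>\<^sup>+x. ennreal (g (vec_lambda x, y)) \<partial>(\<Pi>\<^sub>M i\<in>(UNIV :: 'n set). complex_normal 1))"
      unfolding X_law' using g_meas vec
      by (subst nn_integral_distr) (auto cong: measurable_cong_sets sets_PiM_cong intro!: measurable_compose[OF _ g_meas])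
    also have "\<dots> = (\<integral>\<^sup>+x. ennreal (Re (det A)) * (ennreal (exp (- q (vec_lambda x) y)) * ennreal (exp (\<Sum>j\<in>UNIV. (cmod (x j))\<^sup>2)))
       \<partial>(\<Pi>\<^sub>M i\<in>(UNIV :: 'n set). complex_normal 1))"
      using detA by (intro nn_integral_cong)
        (simp add: g_def cip_self ennreal_mult[symmetric] exp_diff exp_minus field_simps del: of_real_sum)
    also have "\<dots> = 1"
      using det[of "L *v (c *\<^sub>R y)"] meas[of y] unfolding q_def
      by (subst nn_integral_cmult) simp_all
    finally show ?thesis .
  qed
  \<comment> \<open>The mean is the trace of \<open>A ** C\<close>, that is, of the identity; it
    cancels against the mean of \<open>|X|^2\<close> in the expectation of
    \<open>ln g\<close>.\<close>
  have q_int: "has_bochner_integral M (\<lambda>\<omega>. q (X \<omega>) (Y \<omega>)) (real CARD('n))"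
  proof -
    have "has_bochner_integral M (\<lambda>\<omega>. Re (trace (A ** outer (d \<omega>) (d \<omega>)))) (Re (trace (A ** C)))"
      by (intro has_bochner_integral_bounded_linear[OF bounded_linear_Re]
        has_bochner_integral_bounded_linear[OF bounded_linear_trace]
        has_bochner_integral_bounded_linear[OF bounded_linear_matrix_mult_left] dd)
    moreover have "Re (trace (A ** C)) = real CARD('n)" by (simp add: AC trace_I)
    moreover have "q (X \<omega>) (Y \<omega>) = Re (trace (A ** outer (d \<omega>) (d \<omega>)))" if "\<omega> \<in> space M" for \<omega>
      using that matrix_vector_mult_diff_rdistrib[of 0 L "s \<omega>"]
      unfolding cip_eq_trace[symmetric] q_def d_def by (simp add: s)
    ultimately show ?thesis
      by (simp cong: has_bochner_integral_cong)
  qed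
  have x_int: "has_bochner_integral M (\<lambda>\<omega>. Re (cip (X \<omega>) (X \<omega>))) (real CARD('n))"
  proof -
    have "has_bochner_integral M (\<lambda>\<omega>. Re (trace (outer (X \<omega>) (X \<omega>)))) (Re (trace (mat 1 :: complex^'n^'n)))"
      by (intro has_bochner_integral_bounded_linear[OF bounded_linear_Re]
        has_bochner_integral_bounded_linear[OF bounded_linear_trace] XX)
    then show ?thesis
      using cip_eq_trace[of "X _" "mat 1"] by (simp add: trace_I)
  qed
  have ln_g: "ln (g (x, y)) = ln (Re (det A)) + (Re (cip x x) - q x y)" for x y
    using detA by (simp add: g_def ln_mult)
  have "has_bochner_integral M (\<lambda>\<omega>. ln (Re (det A)) + (Re (cip (X \<omega>) (X \<omega>)) - q (X \<omega>) (Y \<omega>)))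
     (ln (Re (det A)) + (real CARD('n) - real CARD('n)))"
    using prob_space by (intro has_bochner_integral_add has_bochner_integral_diff q_int x_int)
      (simp add: has_bochner_integral_iff)
  then have "has_bochner_integral M (\<lambda>\<omega>. ln (g (X \<omega>, Y \<omega>))) (ln (Re (det A)))"
    by (simp add: ln_g)
  then have "has_bochner_integral ?Q (\<lambda>z. ln (g z)) (ln (Re (det A)))"
    using g_meas by (intro has_bochner_integral_distr) auto
  then have ln_int: "integrable ?Q (\<lambda>z. ln (g z))" "(\<integral>z. ln (g z) \<partial>?Q) = ln (Re (det A))"
    by (simp_all add: has_bochner_integral_iff)
  show ?thesis
  proof (cases "absolutely_continuous ?Pr ?Q \<and> integrable ?Q (entropy_density 2 ?Pr ?Q)")
    case True
    have "(\<integral>z. ln (g z) \<partial>?Q) / ln 2 \<le> KL_divergence 2 ?Pr ?Q"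
    proof (rule XY.log_integral_le_KL_divergence)
      show "prob_space ?Q" by (rule prob_space_distr) simp
      show "(\<integral>\<^sup>+z. ennreal (g z) \<partial>?Pr) \<le> 1"
        using g_meas by (subst XY.nn_integral_snd[symmetric]) (auto simp: g1 Y.emeasure_space_1[simplified])
    qed (use True g_meas detA ln_int in \<open>auto simp: g_def\<close>)
    then show ?thesis
      using True unfolding ln_int(2) A_def[symmetric]
      by (simp add: mutual_information_ext_def mutual_information_def log_def Let_def)
  next
    case False
    then show ?thesis by (auto simp: mutual_information_ext_def Let_def)
  qed
qed

subsection \<open>Second moments of random linear combinations\<close>

text \<open>A vector is the finite sum of its components along the axes. Used twice in a row, this
  reduces a matrix expectation to its entries.\<close>

lemma has_bochner_integral_vecI:
  fixes f :: "'a \<Rightarrow> 'b::euclidean_space^'n"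
  assumes "\<And>i. has_bochner_integral M (\<lambda>x. f x $ i) (r $ i)"
  shows "has_bochner_integral M f r"
proof -
  have ax: "bounded_linear (axis i :: 'b \<Rightarrow> 'b^'n)" for i
    unfolding linear_conv_bounded_linear[symmetric] by (rule linearI) (auto simp: axis_def vec_eq_iff)
  have "(\<Sum>i\<in>UNIV. axis i (v $ i)) = v" for v :: "'b^'n"
    by (simp add: vec_eq_iff axis_def)
  moreover have "has_bochner_integral M (\<lambda>x. \<Sum>i\<in>UNIV. axis i (f x $ i)) (\<Sum>i\<in>UNIV. axis i (r $ i))"
    by (intro has_bochner_integral_sum has_bochner_integral_bounded_linear[OF ax] assms)
  ultimately show ?thesis by simp
qed

lemma distr_complex_normal:
  assumes "0 < v"
  shows "distr (complex_normal v) borel Re = density lborel (normal_density 0 (sqrt (v / 2)))" (is "_ = ?N")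
    and "distr (complex_normal v) borel Im = density lborel (normal_density 0 (sqrt (v / 2)))"
proof -
  interpret N: prob_space ?N
    by (rule prob_space_normal_density) (use assms in simp)
  have N: "distr (?N \<Otimes>\<^sub>M ?N) borel fst = ?N"
    using N.distr_pair_fst[of ?N] by (simp cong: distr_cong)
  show "distr (complex_normal v) borel Re = ?N"
    unfolding complex_normal_def by (subst distr_distr) (auto simp: N comp_def case_prod_beta)
  have "distr (?N \<Otimes>\<^sub>M ?N) borel snd = ?N"
  proof (rule measure_eqI)
    fix A assume "A \<in> sets (distr (?N \<Otimes>\<^sub>M ?N) borel snd)"
    then have A: "A \<in> sets borel" by simp
    have "snd -` A \<inter> space (?N \<Otimes>\<^sub>M ?N) = UNIV \<times> A" by (auto simp: space_pair_measure)
    with A show "emeasure (distr (?N \<Otimes>\<^sub>M ?N) borel snd) A = emeasure ?N A"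
      using N.emeasure_pair_measure_Times[of UNIV ?N A] N.emeasure_space_1
      by (subst emeasure_distr) auto
  qed simp
  then show "distr (complex_normal v) borel Im = ?N"
    unfolding complex_normal_def by (subst distr_distr) (auto simp: comp_def case_prod_beta)
qed

lemma has_bochner_integral_complex_normal_ReIm:
  fixes g :: "real \<Rightarrow> real"
  assumes v: "0 < v" and [measurable]: "g \<in> borel_measurable borel"
    and g: "has_bochner_integral lborel (\<lambda>x. normal_density 0 (sqrt (v / 2)) x * g x) c"
  shows "has_bochner_integral (complex_normal v) (\<lambda>z. g (Re z)) c"
    and "has_bochner_integral (complex_normal v) (\<lambda>z. g (Im z)) c"
proof -
  have g': "has_bochner_integral (density lborel (normal_density 0 (sqrt (v / 2)))) g c"
    using g by (intro has_bochner_integral_density) auto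
  show "has_bochner_integral (complex_normal v) (\<lambda>z. g (Re z)) c"
    using g' unfolding distr_complex_normal(1)[OF v, symmetric]
    by (simp add: has_bochner_integral_iff integrable_distr_eq integral_distr)
  show "has_bochner_integral (complex_normal v) (\<lambda>z. g (Im z)) c"
    using g' unfolding distr_complex_normal(2)[OF v, symmetric]
    by (simp add: has_bochner_integral_iff integrable_distr_eq integral_distr)
qed

text \<open>Real and imaginary parts are centred normal with variance \<open>v / 2\<close> each. The
  fourth moment is what makes the entries of \<open>T\<close>, which are of degree four in the
  channels, finite.\<close>

lemma complex_normal_moments:
  assumes v: "0 < v"
  shows "has_bochner_integral (complex_normal v) (\<lambda>z. z) 0"
    and "has_bochner_integral (complex_normal v) (\<lambda>z. (cmod z)\<^sup>2) v"
    and "integrable (complex_normal v) (\<lambda>z. cmod z ^ 4)"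
proof -
  have s: "0 < sqrt (v / 2)" using v by simp
  have m1: "has_bochner_integral lborel (\<lambda>x. normal_density 0 (sqrt (v / 2)) x * x) 0"
    using normal_moment_odd[OF s, of 0 0] by simp
  have m2: "has_bochner_integral lborel (\<lambda>x. normal_density 0 (sqrt (v / 2)) x * x\<^sup>2) (v / 2)"
    using normal_moment_even[OF s, of 0 1] v by (simp add: field_simps power2_eq_square)
  have m4: "integrable lborel (\<lambda>x. normal_density 0 (sqrt (v / 2)) x * x ^ 4)"
    using integrable_normal_moment[OF s, of 0 4] by simp
  note I1 = has_bochner_integral_complex_normal_ReIm[OF v _ m1]
    and I2 = has_bochner_integral_complex_normal_ReIm[OF v _ m2]
    and I4 = has_bochner_integral_complex_normal_ReIm[OF v _ has_bochner_integral_integrable[OF m4]]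
  have "has_bochner_integral (complex_normal v) (\<lambda>z. of_real (Re z) + \<i> * of_real (Im z)) (of_real 0 + \<i> * of_real 0)"
    by (intro has_bochner_integral_add has_bochner_integral_mult_right has_bochner_integral_of_real I1) auto
  then show "has_bochner_integral (complex_normal v) (\<lambda>z. z) 0"
    by (simp add: complex_eq[symmetric])
  have "has_bochner_integral (complex_normal v) (\<lambda>z. (Re z)\<^sup>2 + (Im z)\<^sup>2) (v / 2 + v / 2)"
    by (intro has_bochner_integral_add I2) auto
  then show "has_bochner_integral (complex_normal v) (\<lambda>z. (cmod z)\<^sup>2) v"
    by (simp add: cmod_power2)
  have i4: "integrable (complex_normal v) (\<lambda>z. 2 * (Re z ^ 4 + Im z ^ 4))"
    using I4 by (intro integrable_mult_right integrable_add) (auto simp: has_bochner_integral_iff)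
  show "integrable (complex_normal v) (\<lambda>z. cmod z ^ 4)"
  proof (rule Bochner_Integration.integrable_bound[OF i4])
    have "cmod z ^ 4 \<le> 2 * (Re z ^ 4 + Im z ^ 4)" for z
    proof -
      have "cmod z ^ 4 = ((Re z)\<^sup>2 + (Im z)\<^sup>2)\<^sup>2"
        by (simp add: cmod_power2[symmetric])
      also have "\<dots> \<le> 2 * (Re z ^ 4 + Im z ^ 4)"
        using zero_le_power2[of "(Re z)\<^sup>2 - (Im z)\<^sup>2"] by (simp add: power2_eq_square power4_eq_xxxx algebra_simps)
      finally show ?thesis .
    qed
    then show "AE z in complex_normal v. norm (cmod z ^ 4) \<le> norm (2 * (Re z ^ 4 + Im z ^ 4))"
      by (simp add: order_trans[OF _ abs_ge_self])
  qed (simp cong: measurable_cong_sets)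
qed

text \<open>Membership in the space L^n. The exponents 4, 2 and 1 occur: a product of two factors
  halves the exponent, from channel entries to products of two channels to integrable
  functions.\<close>

definition finite_moment :: "'a measure \<Rightarrow> nat \<Rightarrow> ('a \<Rightarrow> complex) \<Rightarrow> bool" where
  "finite_moment M n f \<longleftrightarrow> f \<in> borel_measurable M \<and> integrable M (\<lambda>x. cmod (f x) ^ n)"

lemma finite_moment_1: "finite_moment M 1 f \<longleftrightarrow> integrable M f"
  by (auto simp: finite_moment_def integrable_norm_iff)

lemma finite_moment_cnj: "finite_moment M n f \<Longrightarrow> finite_moment M n (\<lambda>x. cnj (f x))"
  unfolding finite_moment_def
  by (auto intro!: measurable_compose[of f M borel cnj] borel_measurable_continuous_onI continuous_intros)

lemma finite_moment_cmult: "finite_moment M n f \<Longrightarrow> finite_moment M n (\<lambda>x. c * f x)"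
  by (auto simp: finite_moment_def norm_mult power_mult_distrib)

lemma finite_moment_add:
  assumes "finite_moment M n f" "finite_moment M n g"
  shows "finite_moment M n (\<lambda>x. f x + g x)"
proof -
  have [measurable]: "f \<in> borel_measurable M" "g \<in> borel_measurable M"
    using assms by (auto simp: finite_moment_def)
  have "integrable M (\<lambda>x. 2 ^ n * (cmod (f x) ^ n + cmod (g x) ^ n))"
    using assms by (auto simp: finite_moment_def)
  then have "integrable M (\<lambda>x. cmod (f x + g x) ^ n)"
  proof (rule Bochner_Integration.integrable_bound)
    show "AE x in M. norm (cmod (f x + g x) ^ n) \<le> norm (2 ^ n * (cmod (f x) ^ n + cmod (g x) ^ n))"
    proof (rule AE_I2)
      fix x
      let ?m = "max (cmod (f x)) (cmod (g x))"
      have "cmod (f x + g x) ^ n \<le> (2 * ?m) ^ n"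
        by (intro power_mono order_trans[OF norm_triangle_ineq]) auto
      also have "\<dots> \<le> 2 ^ n * (cmod (f x) ^ n + cmod (g x) ^ n)"
        by (auto simp: power_mult_distrib max_def)
      finally show "norm (cmod (f x + g x) ^ n) \<le> norm (2 ^ n * (cmod (f x) ^ n + cmod (g x) ^ n))"
        by simp
    qed
  qed simp
  then show ?thesis by (simp add: finite_moment_def)
qed

lemma finite_moment_sum:
  assumes "0 < n" "\<And>i. i \<in> I \<Longrightarrow> finite_moment M n (f i)"
  shows "finite_moment M n (\<lambda>x. \<Sum>i\<in>I. f i x)"
  using assms(2)
proof (induction I rule: infinite_finite_induct)
  case (insert i I)
  then show ?case by (simp add: finite_moment_add)
qed (use assms(1) in \<open>simp_all add: finite_moment_def zero_power\<close>)

text \<open>A pointwise arithmetic-geometric mean bound replaces Hoelder's inequality.\<close>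

lemma finite_moment_mult:
  assumes "finite_moment M (2 * n) f" "finite_moment M (2 * n) g"
  shows "finite_moment M n (\<lambda>x. f x * g x)"
proof -
  have [measurable]: "f \<in> borel_measurable M" "g \<in> borel_measurable M"
    using assms by (auto simp: finite_moment_def)
  have "integrable M (\<lambda>x. cmod (f x) ^ (2 * n) + cmod (g x) ^ (2 * n))"
    using assms by (auto simp: finite_moment_def)
  then have "integrable M (\<lambda>x. cmod (f x * g x) ^ n)"
  proof (rule Bochner_Integration.integrable_bound)
    have "a ^ n * b ^ n \<le> a ^ (2 * n) + b ^ (2 * n)" if "0 \<le> a" "0 \<le> b" for a b :: real
    proof -
      have "2 * a ^ n * b ^ n \<le> (a ^ n)\<^sup>2 + (b ^ n)\<^sup>2" "0 \<le> a ^ n * b ^ n"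
        using sum_squares_bound[of "a ^ n" "b ^ n"] that by simp_all
      then show ?thesis
        by (simp add: power_mult mult.commute[of 2 n])
    qed
    then show "AE x in M. norm (cmod (f x * g x) ^ n) \<le> norm (cmod (f x) ^ (2 * n) + cmod (g x) ^ (2 * n))"
      by (simp add: norm_mult power_mult_distrib)
  qed simp
  then show ?thesis by (simp add: finite_moment_def)
qed

lemma (in prob_space) indep_vars_integral_mult:
  fixes F G :: "('i \<Rightarrow> complex) \<Rightarrow> complex"
  assumes ind: "indep_vars (\<lambda>_. borel) \<xi> I" and AB: "A \<inter> B = {}" "A \<subseteq> I" "B \<subseteq> I"
    and F: "F \<in> borel_measurable (\<Pi>\<^sub>M i\<in>A. borel)" and G: "G \<in> borel_measurable (\<Pi>\<^sub>M i\<in>B. borel)"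
    and iF: "has_bochner_integral M (\<lambda>\<omega>. F (restrict (\<lambda>i. \<xi> i \<omega>) A)) a"
    and iG: "has_bochner_integral M (\<lambda>\<omega>. G (restrict (\<lambda>i. \<xi> i \<omega>) B)) b"
  shows "has_bochner_integral M (\<lambda>\<omega>. F (restrict (\<lambda>i. \<xi> i \<omega>) A) * G (restrict (\<lambda>i. \<xi> i \<omega>) B)) (a * b)"
proof -
  have "indep_var borel (F \<circ> (\<lambda>\<omega>. restrict (\<lambda>i. \<xi> i \<omega>) A)) borel (G \<circ> (\<lambda>\<omega>. restrict (\<lambda>i. \<xi> i \<omega>) B))"
    by (rule indep_var_compose[OF indep_var_restrict[OF ind AB] F G])
  from indep_var_integrable[OF this] indep_var_lebesgue_integral[OF this] iF iG show ?thesis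
    by (simp add: has_bochner_integral_iff comp_def)
qed

text \<open>The coefficients depend on the family \<open>A\<close> alone and are thus independent of
  the centred, pairwise uncorrelated variables indexed by \<open>J\<close>. In the expanded double
  sum each expectation factors, and only the diagonal survives. All three second-moment matrices of
  the model are instances.\<close>

lemma (in prob_space) has_bochner_integral_random_combination:
  fixes \<xi> :: "'i \<Rightarrow> 'a \<Rightarrow> complex" and c d :: "'i \<Rightarrow> ('i \<Rightarrow> complex) \<Rightarrow> complex"
  assumes ind: "indep_vars (\<lambda>_. borel) \<xi> I" and AJ: "A \<inter> J = {}" "A \<subseteq> I" "J \<subseteq> I" and J: "finite J"
    and mean: "\<And>j. j \<in> J \<Longrightarrow> has_bochner_integral M (\<xi> j) 0"
    and var: "\<And>j. j \<in> J \<Longrightarrow> has_bochner_integral M (\<lambda>\<omega>. (cmod (\<xi> j \<omega>))\<^sup>2) (v j)"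
    and c: "\<And>j. j \<in> J \<Longrightarrow> c j \<in> borel_measurable (\<Pi>\<^sub>M i\<in>A. borel)"
    and d: "\<And>j. j \<in> J \<Longrightarrow> d j \<in> borel_measurable (\<Pi>\<^sub>M i\<in>A. borel)"
    and c2: "\<And>j. j \<in> J \<Longrightarrow> finite_moment M 2 (\<lambda>\<omega>. c j (restrict (\<lambda>i. \<xi> i \<omega>) A))"
    and d2: "\<And>j. j \<in> J \<Longrightarrow> finite_moment M 2 (\<lambda>\<omega>. d j (restrict (\<lambda>i. \<xi> i \<omega>) A))"
  shows "has_bochner_integral M (\<lambda>\<omega>. (\<Sum>j\<in>J. c j (restrict (\<lambda>i. \<xi> i \<omega>) A) * \<xi> j \<omega>) *
      cnj (\<Sum>j\<in>J. d j (restrict (\<lambda>i. \<xi> i \<omega>) A) * \<xi> j \<omega>))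
    (\<Sum>j\<in>J. (\<integral>\<omega>. c j (restrict (\<lambda>i. \<xi> i \<omega>) A) * cnj (d j (restrict (\<lambda>i. \<xi> i \<omega>) A)) \<partial>M) * of_real (v j))"
proof -
  let ?R = "\<lambda>\<omega>. restrict (\<lambda>i. \<xi> i \<omega>)"
  have cnj_meas: "(\<lambda>x. cnj (f x)) \<in> borel_measurable N" if "f \<in> borel_measurable N" for f and N :: "'x measure"
    using that by (rule measurable_compose) (intro borel_measurable_continuous_onI continuous_intros)
  have corr: "has_bochner_integral M (\<lambda>\<omega>. \<xi> j \<omega> * cnj (\<xi> l \<omega>)) (if j = l then of_real (v j) else 0)"
    if jl: "j \<in> J" "l \<in> J" for j l
  proof (cases "j = l")
    case True
    then show ?thesis
      using has_bochner_integral_of_real[OF var[OF jl(1)], where 'a=complex]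
      by (simp only: complex_norm_square refl if_True)
  next
    case False
    have "has_bochner_integral M (\<lambda>\<omega>. cnj (\<xi> l \<omega>)) (cnj 0)"
      by (rule has_bochner_integral_bounded_linear[OF bounded_linear_cnj mean[OF jl(2)]])
    then have "has_bochner_integral M (\<lambda>\<omega>. (\<lambda>w. w j) (?R \<omega> {j}) * (\<lambda>w. cnj (w l)) (?R \<omega> {l})) (0 * 0)"
      using mean[OF jl(1)] AJ jl False
      by (intro indep_vars_integral_mult[OF ind] cnj_meas) auto
    with False show ?thesis by simp
  qed
  have summand: "has_bochner_integral M (\<lambda>\<omega>. (c j (?R \<omega> A) * cnj (d l (?R \<omega> A))) * (\<xi> j \<omega> * cnj (\<xi> l \<omega>)))
     ((\<integral>\<omega>. c j (?R \<omega> A) * cnj (d l (?R \<omega> A)) \<partial>M) * (if j = l then of_real (v j) else 0))"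
    if jl: "j \<in> J" "l \<in> J" for j l
  proof -
    have "integrable M (\<lambda>\<omega>. c j (?R \<omega> A) * cnj (d l (?R \<omega> A)))"
      unfolding finite_moment_1[symmetric]
      by (intro finite_moment_mult finite_moment_cnj) (use c2 d2 jl in simp_all)
    then have 1: "has_bochner_integral M (\<lambda>\<omega>. (\<lambda>w. c j w * cnj (d l w)) (?R \<omega> A)) (\<integral>\<omega>. c j (?R \<omega> A) * cnj (d l (?R \<omega> A)) \<partial>M)"
      by (simp add: has_bochner_integral_iff)
    have 2: "has_bochner_integral M (\<lambda>\<omega>. (\<lambda>w. w j * cnj (w l)) (?R \<omega> {j, l})) (if j = l then of_real (v j) else 0)"
      using corr[OF jl] by simp
    have "has_bochner_integral M (\<lambda>\<omega>. (\<lambda>w. c j w * cnj (d l w)) (?R \<omega> A) * (\<lambda>w. w j * cnj (w l)) (?R \<omega> {j, l}))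
     ((\<integral>\<omega>. c j (?R \<omega> A) * cnj (d l (?R \<omega> A)) \<partial>M) * (if j = l then of_real (v j) else 0))"
      \<comment> \<open>\<open>{j, l}\<close> is treated as one block disjoint from
        \<open>A\<close>, so the diagonal and off-diagonal cases need no separate argument.\<close>
      by (rule indep_vars_integral_mult[OF ind _ _ _ _ _ 1 2])
        (use AJ jl c d in \<open>auto intro!: borel_measurable_times cnj_meas\<close>)
    then show ?thesis by simp
  qed
  have "has_bochner_integral M (\<lambda>\<omega>. \<Sum>j\<in>J. \<Sum>l\<in>J. (c j (?R \<omega> A) * cnj (d l (?R \<omega> A))) * (\<xi> j \<omega> * cnj (\<xi> l \<omega>)))
     (\<Sum>j\<in>J. \<Sum>l\<in>J. (\<integral>\<omega>. c j (?R \<omega> A) * cnj (d l (?R \<omega> A)) \<partial>M) * (if j = l then of_real (v j) else 0))"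
    by (intro has_bochner_integral_sum summand)
  then show ?thesis
    using J by (simp add: sum_product cnj_sum ac_simps if_distrib cong: if_cong)
qed

subsection \<open>Maximum ratio combining\<close>

lemma sum_image_pairs:
  fixes g :: "'c \<Rightarrow> 'd::comm_monoid_add"
  assumes "inj_on (\<lambda>(i, j). f i j) (I \<times> J)"
  shows "sum g ((\<lambda>(i, j). f i j) ` (I \<times> J)) = (\<Sum>i\<in>I. \<Sum>j\<in>J. g (f i j))"
  unfolding sum.reindex[OF assms] by (simp add: sum.cartesian_product case_prod_beta)

text \<open>All scalar variables form one independent family. Given the channel entries, both
  \<open>x k\<close> and the sum of the local estimates are linear in the data and noise entries, so
  their second moments follow from one lemma and match \<open>E\<close> and
  \<open>Psi\<close>.\<close>

theorem theorem1:
  fixes P :: "'w measure"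
    and M K :: nat and k :: nat
    and p \<sigma>2 :: real
    and Ur :: "nat \<Rightarrow> complex^'a^'r"
    and Us :: "nat \<Rightarrow> complex^'b^'s"
    and Sig :: "nat \<Rightarrow> nat \<Rightarrow> real^'b^'a"
    and W :: "nat \<Rightarrow> nat \<Rightarrow> 'w \<Rightarrow> complex^'b^'a"
    and H :: "nat \<Rightarrow> nat \<Rightarrow> 'w \<Rightarrow> complex^'s^'r"
    and x :: "nat \<Rightarrow> 'w \<Rightarrow> complex^'s"
    and n :: "nat \<Rightarrow> 'w \<Rightarrow> complex^'r"
    and y :: "nat \<Rightarrow> 'w \<Rightarrow> complex^'r"
    and V :: "nat \<Rightarrow> nat \<Rightarrow> 'w \<Rightarrow> complex^'s^'r"
    and xcheck :: "nat \<Rightarrow> nat \<Rightarrow> 'w \<Rightarrow> complex^'s"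
    and xhat :: "nat \<Rightarrow> 'w \<Rightarrow> complex^'s"
    and Z :: "nat \<Rightarrow> nat \<Rightarrow> complex^'s^'s"
    and T :: "nat \<Rightarrow> nat \<Rightarrow> nat \<Rightarrow> nat \<Rightarrow> complex^'s^'s"
    and E Psi :: "complex^'s^'s"
    and SE :: real
  assumes prob: "prob_space P"
    and p_pos: "0 < p" and sigma_pos: "0 < \<sigma>2"
    and k_lt: "k < K"
    and indep: "prob_space.indep_vars P (\<lambda>_. borel)
          (\<lambda>i \<omega>. case i of W_ent m k' a b \<Rightarrow> W m k' \<omega> $ a $ b
                         | X_ent k' s \<Rightarrow> x k' \<omega> $ s
                         | N_ent m r \<Rightarrow> n m \<omega> $ r)
          ({W_ent m k' a b | m k' a b. m < M \<and> k' < K}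
           \<union> {X_ent k' s | k' s. k' < K} \<union> {N_ent m r | m r. m < M})"
    and W_dist: "\<And>m k' a b. m < M \<Longrightarrow> k' < K \<Longrightarrow>
          distr P borel (\<lambda>\<omega>. W m k' \<omega> $ a $ b) = complex_normal 1"
    and x_dist: "\<And>k' s. k' < K \<Longrightarrow> distr P borel (\<lambda>\<omega>. x k' \<omega> $ s) = complex_normal 1"
    and n_dist: "\<And>m r. m < M \<Longrightarrow> distr P borel (\<lambda>\<omega>. n m \<omega> $ r) = complex_normal \<sigma>2"
    and H_def: "\<And>m k' \<omega>. m < M \<Longrightarrow> k' < K \<Longrightarrow> \<omega> \<in> space P \<Longrightarrow>
          H m k' \<omega> = Ur m ** hadamard (Sig m k') (W m k' \<omega>) ** cadj (Us k')"
    and y_def: "\<And>m \<omega>. m < M \<Longrightarrow> \<omega> \<in> space P \<Longrightarrow>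
          y m \<omega> = sqrt p *\<^sub>R (\<Sum>k'<K. H m k' \<omega> *v x k' \<omega>) + n m \<omega>"
    and MR: "\<And>m k' \<omega>. m < M \<Longrightarrow> k' < K \<Longrightarrow> \<omega> \<in> space P \<Longrightarrow> V m k' \<omega> = H m k' \<omega>"
    and xcheck_def: "\<And>m k' \<omega>. m < M \<Longrightarrow> k' < K \<Longrightarrow> \<omega> \<in> space P \<Longrightarrow>
          xcheck m k' \<omega> = cadj (V m k' \<omega>) *v y m \<omega>"
    and xhat_def: "\<And>k' \<omega>. k' < K \<Longrightarrow> \<omega> \<in> space P \<Longrightarrow>
          xhat k' \<omega> = (1 / real M) *\<^sub>R (\<Sum>m<M. xcheck m k' \<omega>)"
    and Z_def: "\<And>m k'. Z m k' = (\<integral>\<omega>. cadj (H m k' \<omega>) ** H m k' \<omega> \<partial>P)"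
    and T_def: "\<And>m k' m' l. T m k' m' l =
          (\<integral>\<omega>. cadj (H m k' \<omega>) ** H m l \<omega> ** cadj (H m' l \<omega>) ** H m' k' \<omega> \<partial>P)"
    and E_def: "E = sqrt p *\<^sub>R (\<Sum>m<M. Z m k)"
    and Psi_def: "Psi = p *\<^sub>R (\<Sum>l<K. \<Sum>m<M. \<Sum>m'<M. T m k m' l) - E ** cadj E
                        + \<sigma>2 *\<^sub>R (\<Sum>m<M. Z m k)"
    and Psi_inv: "invertible Psi"
    and SE_def: "SE = log 2 (Re (det (mat 1 + cadj E ** matrix_inv Psi ** E)))"
  shows "ereal SE \<le> mutual_information_ext P 2 borel borel (x k) (xhat k)"
proof -
  interpret prob_space P by (rule prob)
  define \<xi> :: "('a, 'b, 's, 'r) rv_index \<Rightarrow> 'w \<Rightarrow> complex" where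
    "\<xi> i \<omega> = (case i of W_ent m k' a b \<Rightarrow> W m k' \<omega> $ a $ b | X_ent k' s \<Rightarrow> x k' \<omega> $ s | N_ent m r \<Rightarrow> n m \<omega> $ r)" for i \<omega>
  have \<xi>_simps: "\<xi> (X_ent l t) \<omega> = x l \<omega> $ t" "\<xi> (N_ent m r) \<omega> = n m \<omega> $ r" for l t m r \<omega>
    by (simp_all add: \<xi>_def)
  define WI :: "('a, 'b, 's, 'r) rv_index set" where "WI = {W_ent m k' a b | m k' a b. m < M \<and> k' < K}"
  define XI :: "('a, 'b, 's, 'r) rv_index set" where "XI = (\<lambda>(l, t). X_ent l t) ` ({..<K} \<times> UNIV)"
  define NI :: "('a, 'b, 's, 'r) rv_index set" where "NI = (\<lambda>(m, r). N_ent m r) ` ({..<M} \<times> UNIV)"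
  have XI: "XI = {X_ent k' s | k' s. k' < K}" and NI: "NI = {N_ent m r | m r. m < M}"
    by (auto simp: XI_def NI_def)
  have ind: "indep_vars (\<lambda>_. borel) \<xi> (WI \<union> XI \<union> NI)"
    using indep unfolding WI_def XI NI by (simp only: \<xi>_def[abs_def])
  have disj: "WI \<inter> (XI \<union> NI) = {}" "XI \<inter> NI = {}" by (auto simp: WI_def XI NI)
  have fin: "finite XI" "finite NI" by (simp_all add: XI_def NI_def)
  have \<xi>_meas: "\<xi> i \<in> borel_measurable P" if "i \<in> WI \<union> XI \<union> NI" for i
    using ind that by (auto simp: indep_vars_def)
  define v :: "('a, 'b, 's, 'r) rv_index \<Rightarrow> real" where "v i = (case i of N_ent m r \<Rightarrow> \<sigma>2 | _ \<Rightarrow> 1)" for i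
  have v_pos: "0 < v i" for i by (auto simp: v_def sigma_pos split: rv_index.splits)
  have \<xi>_law: "distr P borel (\<xi> i) = complex_normal (v i)" if "i \<in> WI \<union> XI \<union> NI" for i
    using that by (auto simp: WI_def XI NI \<xi>_def[abs_def] v_def W_dist x_dist n_dist)
  have mean: "has_bochner_integral P (\<xi> i) 0" and var: "has_bochner_integral P (\<lambda>\<omega>. (cmod (\<xi> i \<omega>))\<^sup>2) (v i)"
    and fourth: "finite_moment P 4 (\<xi> i)" if "i \<in> WI \<union> XI \<union> NI" for i
    using complex_normal_moments[OF v_pos[of i]] \<xi>_meas[OF that] unfolding \<xi>_law[OF that, symmetric] finite_moment_def
    by (auto simp: has_bochner_integral_iff integrable_distr_eq integral_distr)

  \<comment> \<open>Channels as functions of the channel entries\<close>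
  let ?R = "\<lambda>\<omega>. restrict (\<lambda>i. \<xi> i \<omega>) WI"
  \<comment> \<open>The channel is a deterministic function of the restricted family
    \<open>?R \<omega>\<close>, the form in which independence from data and noise can be
    applied.\<close>
  define Hw :: "(('a, 'b, 's, 'r) rv_index \<Rightarrow> complex) \<Rightarrow> nat \<Rightarrow> nat \<Rightarrow> complex^'s^'r" where
    "Hw w m l = Ur m ** hadamard (Sig m l) (\<chi> a b. w (W_ent m l a b)) ** cadj (Us l)" for w m l
  have H_Hw: "H m l \<omega> = Hw (?R \<omega>) m l" if "m < M" "l < K" "\<omega> \<in> space P" for m l \<omega>
  proof -
    have "(\<chi> a b. ?R \<omega> (W_ent m l a b)) = W m l \<omega>"
      using that by (auto simp: vec_eq_iff WI_def \<xi>_def)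
    then show ?thesis by (simp add: H_def[OF that] Hw_def)
  qed
  have Hw_nth: "Hw w m l $ r $ t = (\<Sum>b\<in>UNIV. \<Sum>a\<in>UNIV. (Ur m $ r $ a * of_real (Sig m l $ a $ b) * cnj (Us l $ t $ b)) * w (W_ent m l a b))" for w m l r t
    by (simp add: Hw_def matrix_matrix_mult_def hadamard_def sum_distrib_right sum_distrib_left ac_simps)
  have Hw_meas: "(\<lambda>w. Hw w m l $ r $ t) \<in> borel_measurable (\<Pi>\<^sub>M i\<in>WI. borel)" if "m < M" "l < K" for m l r t
    unfolding Hw_nth using that
    by (intro borel_measurable_sum borel_measurable_times borel_measurable_const measurable_component_singleton) (auto simp: WI_def)
  have H4: "finite_moment P 4 (\<lambda>\<omega>. Hw (?R \<omega>) m l $ r $ t)" if "m < M" "l < K" for m l r t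
  proof -
    have W: "W_ent m l a b \<in> WI" for a b using that by (auto simp: WI_def)
    then show ?thesis
      unfolding Hw_nth by (intro finite_moment_sum finite_moment_cmult) (auto simp: fourth)
  qed
  have cnj_meas: "(\<lambda>x. cnj (f x)) \<in> borel_measurable N" if "f \<in> borel_measurable N" for f and N :: "'x measure"
    using that by (rule measurable_compose) (intro borel_measurable_continuous_onI continuous_intros)

  \<comment> \<open>Effective channels after combining, and the entries of \<open>Z\<close> and
    \<open>T\<close>\<close>
  define B where "B w m l = cadj (Hw w m k) ** Hw w m l" for w m l
  have B_nth: "B w m l $ a $ t = (\<Sum>r\<in>UNIV. cnj (Hw w m k $ r $ a) * Hw w m l $ r $ t)" for w m l a t
    by (simp add: B_def matrix_matrix_mult_def)
  have B_meas: "(\<lambda>w. B w m l $ a $ t) \<in> borel_measurable (\<Pi>\<^sub>M i\<in>WI. borel)" if "m < M" "l < K" for m l a t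
    unfolding B_nth using that k_lt
    by (intro borel_measurable_sum borel_measurable_times cnj_meas Hw_meas) auto
  have B2: "finite_moment P 2 (\<lambda>\<omega>. B (?R \<omega>) m l $ a $ t)" if "m < M" "l < K" for m l a t
    unfolding B_nth using that k_lt
    by (intro finite_moment_sum finite_moment_mult finite_moment_cnj) (auto simp: H4)
  have H2: "finite_moment P 2 (\<lambda>\<omega>. Hw (?R \<omega>) m l $ r $ t)" if "m < M" "l < K" for m l r t
  proof -
    have "finite_moment P 4 (\<lambda>\<omega>. 1)" by (simp add: finite_moment_def)
    then show ?thesis
      using finite_moment_mult[of P 2 "\<lambda>\<omega>. Hw (?R \<omega>) m l $ r $ t" "\<lambda>\<omega>. 1"] H4[OF that] by simp
  qed
  have integrable_mult_cnj: "integrable P (\<lambda>\<omega>. f \<omega> * cnj (g \<omega>))" if "finite_moment P 2 f" "finite_moment P 2 g" for f g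
    unfolding finite_moment_1[symmetric] by (intro finite_moment_mult finite_moment_cnj) (use that in simp_all)

  \<comment> \<open>Two readings of the same entry: the sum over antennas appears as noise power,
    the entry of \<open>B\<close> as mean effective channel in \<open>E\<close>.\<close>
  have Z_nth: "Z m k $ a $ b = (\<Sum>r\<in>UNIV. \<integral>\<omega>. cnj (Hw (?R \<omega>) m k $ r $ a) * Hw (?R \<omega>) m k $ r $ b \<partial>P)"
    and Z_B: "Z m k $ a $ b = (\<integral>\<omega>. B (?R \<omega>) m k $ a $ b \<partial>P)" if m: "m < M" for m a b
  proof -
    let ?e = "\<lambda>a b r. \<integral>\<omega>. cnj (Hw (?R \<omega>) m k $ r $ a) * Hw (?R \<omega>) m k $ r $ b \<partial>P"
    have "integrable P (\<lambda>\<omega>. cnj (Hw (?R \<omega>) m k $ r $ a) * Hw (?R \<omega>) m k $ r $ b)" for a b r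
      using integrable_mult_cnj[OF H2[OF m k_lt, of r b] H2[OF m k_lt, of r a]] by (simp add: mult.commute)
    then have comp: "has_bochner_integral P (\<lambda>\<omega>. B (?R \<omega>) m k $ a $ b) (\<Sum>r\<in>UNIV. ?e a b r)" for a b
      unfolding B_nth by (intro has_bochner_integral_sum) (simp add: has_bochner_integral_iff)
    have "has_bochner_integral P (\<lambda>\<omega>. B (?R \<omega>) m k) (\<chi> a b. \<Sum>r\<in>UNIV. ?e a b r)"
      by (intro has_bochner_integral_vecI) (simp add: comp)
    moreover have "Z m k = (\<integral>\<omega>. B (?R \<omega>) m k \<partial>P)"
      unfolding Z_def by (intro Bochner_Integration.integral_cong refl) (simp add: B_def H_Hw m k_lt)
    ultimately have "Z m k = (\<chi> a b. \<Sum>r\<in>UNIV. ?e a b r)"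
      by (simp add: has_bochner_integral_iff)
    then show "Z m k $ a $ b = (\<Sum>r\<in>UNIV. ?e a b r)" by simp
    with comp[of a b] show "Z m k $ a $ b = (\<integral>\<omega>. B (?R \<omega>) m k $ a $ b \<partial>P)"
      by (simp add: has_bochner_integral_iff)
  qed
  \<comment> \<open>The product of four channels regroups as \<open>B m l\<close> times the adjoint
    of \<open>B m' l\<close>, so \<open>T\<close> is a correlation of effective channels.\<close>
  have T_nth: "T m k m' l $ a $ b = (\<Sum>t\<in>UNIV. \<integral>\<omega>. B (?R \<omega>) m l $ a $ t * cnj (B (?R \<omega>) m' l $ b $ t) \<partial>P)"
    if m: "m < M" "m' < M" "l < K" for m m' l a b
  proof -
    let ?e = "\<lambda>a b t. \<integral>\<omega>. B (?R \<omega>) m l $ a $ t * cnj (B (?R \<omega>) m' l $ b $ t) \<partial>P"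
    have nth: "(B w m l ** cadj (B w m' l)) $ a $ b = (\<Sum>t\<in>UNIV. B w m l $ a $ t * cnj (B w m' l $ b $ t))" for w a b
      by (simp add: matrix_matrix_mult_def)
    have "has_bochner_integral P (\<lambda>\<omega>. (B (?R \<omega>) m l ** cadj (B (?R \<omega>) m' l)) $ a $ b) (\<Sum>t\<in>UNIV. ?e a b t)" for a b
      unfolding nth using integrable_mult_cnj[OF B2 B2] m
      by (intro has_bochner_integral_sum) (simp add: has_bochner_integral_iff)
    then have "has_bochner_integral P (\<lambda>\<omega>. B (?R \<omega>) m l ** cadj (B (?R \<omega>) m' l)) (\<chi> a b. \<Sum>t\<in>UNIV. ?e a b t)"
      by (intro has_bochner_integral_vecI) simp
    moreover have "T m k m' l = (\<integral>\<omega>. B (?R \<omega>) m l ** cadj (B (?R \<omega>) m' l) \<partial>P)"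
      unfolding T_def by (intro Bochner_Integration.integral_cong refl)
        (simp add: B_def H_Hw m k_lt cadj_mult matrix_mul_assoc)
    ultimately have "T m k m' l = (\<chi> a b. \<Sum>t\<in>UNIV. ?e a b t)"
      by (simp add: has_bochner_integral_iff)
    then show ?thesis by simp
  qed

  \<comment> \<open>Sum of the estimates and data as random combinations\<close>
  define s where "s \<omega> = (\<Sum>m<M. xcheck m k \<omega>)" for \<omega>
  \<comment> \<open>Coefficients of component \<open>a\<close> of \<open>s\<close>: all base
    stations see the same data entry, so their effective channels add up, whereas each noise entry
    meets one station only. The default 0 concerns channel entries, over which the sum never
    runs.\<close>
  define cf where "cf a j w = (case j of X_ent l t \<Rightarrow> of_real (sqrt p) * (\<Sum>m<M. B w m l $ a $ t)
      | N_ent m r \<Rightarrow> cnj (Hw w m k $ r $ a) | _ \<Rightarrow> 0)" for a and j :: "('a, 'b, 's, 'r) rv_index" and w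
  define df where "df b j w = (if j = X_ent k b then 1 else 0 :: complex)"
    for b and j :: "('a, 'b, 's, 'r) rv_index" and w :: "('a, 'b, 's, 'r) rv_index \<Rightarrow> complex"
  have sum_XN: "sum f (XI \<union> NI) = (\<Sum>l<K. \<Sum>t\<in>UNIV. f (X_ent l t)) + (\<Sum>m<M. \<Sum>r\<in>UNIV. f (N_ent m r))"
    for f :: "('a, 'b, 's, 'r) rv_index \<Rightarrow> complex"
    using fin disj unfolding XI_def NI_def
    by (subst sum.union_disjoint) (auto simp: inj_on_def intro!: arg_cong2[where f="(+)"] sum_image_pairs)
  have s_eq: "s \<omega> $ a = (\<Sum>j\<in>XI \<union> NI. cf a j (?R \<omega>) * \<xi> j \<omega>)" if \<omega>: "\<omega> \<in> space P" for \<omega> a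
  proof -
    let ?H = "Hw (?R \<omega>)"
    have "xcheck m k \<omega> = (\<Sum>l<K. sqrt p *\<^sub>R (B (?R \<omega>) m l *v x l \<omega>)) + cadj (?H m k) *v n m \<omega>" if m: "m < M" for m
    proof -
      have "xcheck m k \<omega> = cadj (?H m k) *v (sqrt p *\<^sub>R (\<Sum>l<K. ?H m l *v x l \<omega>) + n m \<omega>)"
        using m \<omega> k_lt by (simp add: xcheck_def MR y_def H_Hw)
      also have "\<dots> = (\<Sum>l<K. sqrt p *\<^sub>R (B (?R \<omega>) m l *v x l \<omega>)) + cadj (?H m k) *v n m \<omega>"
        unfolding matrix_vector_right_distrib linear_scale[OF matrix_vector_mul_linear] linear_sum[OF matrix_vector_mul_linear]
        by (simp add: B_def scaleR_sum_right matrix_vector_mul_assoc)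
      finally show ?thesis .
    qed
    then have "s \<omega> $ a = (\<Sum>m<M. (\<Sum>l<K. of_real (sqrt p) * (B (?R \<omega>) m l *v x l \<omega>) $ a) + (cadj (?H m k) *v n m \<omega>) $ a)"
      by (simp add: s_def scaleR_conv_of_real[where 'a=complex])
    also have "\<dots> = (\<Sum>l<K. \<Sum>m<M. of_real (sqrt p) * (B (?R \<omega>) m l *v x l \<omega>) $ a) + (\<Sum>m<M. (cadj (?H m k) *v n m \<omega>) $ a)"
      unfolding sum.distrib by (subst sum.swap) (rule refl)
    also have "(\<Sum>l<K. \<Sum>m<M. of_real (sqrt p) * (B (?R \<omega>) m l *v x l \<omega>) $ a) =
       (\<Sum>l<K. \<Sum>t\<in>UNIV. of_real (sqrt p) * (\<Sum>m<M. B (?R \<omega>) m l $ a $ t) * x l \<omega> $ t)"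
      unfolding matrix_vector_mult_def vec_lambda_beta sum_distrib_left sum_distrib_right mult.assoc
      by (intro sum.cong refl) (rule sum.swap)
    finally show ?thesis
      unfolding sum_XN cf_def \<xi>_simps matrix_vector_mult_def rv_index.case vec_lambda_beta cadj_nth .
  qed
  have x_eq: "x k \<omega> $ b = (\<Sum>j\<in>XI \<union> NI. df b j (?R \<omega>) * \<xi> j \<omega>)" for \<omega> b
  proof -
    have "(\<Sum>j\<in>XI \<union> NI. df b j (?R \<omega>) * \<xi> j \<omega>) = (\<Sum>j\<in>XI \<union> NI. if j = X_ent k b then \<xi> j \<omega> else 0)"
      by (intro sum.cong refl) (simp add: df_def)
    also have "\<dots> = \<xi> (X_ent k b) \<omega>" using k_lt fin by (auto simp: XI)
    finally show ?thesis by (simp add: \<xi>_simps)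
  qed
  have cf_meas: "cf a j \<in> borel_measurable (\<Pi>\<^sub>M i\<in>WI. borel)" if "j \<in> XI \<union> NI" for a j
    using that k_lt
    by (auto simp: XI NI cf_def[abs_def] intro!: borel_measurable_times borel_measurable_sum borel_measurable_const cnj_meas Hw_meas B_meas)
  have df_meas: "df b j \<in> borel_measurable (\<Pi>\<^sub>M i\<in>WI. borel)" for b j
    by (simp add: df_def[abs_def])
  have cf2: "finite_moment P 2 (\<lambda>\<omega>. cf a j (?R \<omega>))" if "j \<in> XI \<union> NI" for a j
    using that k_lt
    by (auto simp: XI NI cf_def intro!: finite_moment_cmult finite_moment_sum finite_moment_cnj H2 B2)
  have df2: "finite_moment P 2 (\<lambda>\<omega>. df b j (?R \<omega>))" for b j
    by (simp add: df_def finite_moment_def)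
  have J: "WI \<subseteq> WI \<union> XI \<union> NI" "XI \<union> NI \<subseteq> WI \<union> XI \<union> NI" "finite (XI \<union> NI)"
    using fin by auto
  note combination = has_bochner_integral_random_combination[OF ind disj(1) J mean[OF subsetD[OF J(2)]] var[OF subsetD[OF J(2)]]]

  \<comment> \<open>The three second-moment matrices\<close>
  have XX: "has_bochner_integral P (\<lambda>\<omega>. outer (x k \<omega>) (x k \<omega>)) (mat 1)"
  proof (intro has_bochner_integral_vecI)
    fix a b
    have eq: "(\<Sum>j\<in>XI \<union> NI. (\<integral>\<omega>. df a j (?R \<omega>) * cnj (df b j (?R \<omega>)) \<partial>P) * of_real (v j)) = (mat 1 :: complex^'s^'s) $ a $ b"
    proof -
      have "(\<Sum>j\<in>XI \<union> NI. (\<integral>\<omega>. df a j (?R \<omega>) * cnj (df b j (?R \<omega>)) \<partial>P) * of_real (v j)) =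
        (\<Sum>j\<in>XI \<union> NI. if j = X_ent k a then (if a = b then 1 else 0) else 0)"
        by (intro sum.cong refl) (auto simp: df_def v_def prob_space)
      also have "\<dots> = (if a = b then 1 else 0)" using k_lt fin by (auto simp: XI)
      finally show ?thesis by (simp add: mat_def)
    qed
    have "has_bochner_integral P (\<lambda>\<omega>. x k \<omega> $ a * cnj (x k \<omega> $ b)) ((mat 1 :: complex^'s^'s) $ a $ b)"
      unfolding eq[symmetric] x_eq by (rule combination) (assumption | rule cf_meas df_meas cf2 df2)+
    then show "has_bochner_integral P (\<lambda>\<omega>. outer (x k \<omega>) (x k \<omega>) $ a $ b) ((mat 1 :: complex^'s^'s) $ a $ b)"
      by (simp add: outer_def)
  qed
  have sX: "has_bochner_integral P (\<lambda>\<omega>. outer (s \<omega>) (x k \<omega>)) E"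
  proof (intro has_bochner_integral_vecI)
    fix a b
    have eq: "(\<Sum>j\<in>XI \<union> NI. (\<integral>\<omega>. cf a j (?R \<omega>) * cnj (df b j (?R \<omega>)) \<partial>P) * of_real (v j)) = E $ a $ b"
    proof -
      have "(\<Sum>j\<in>XI \<union> NI. (\<integral>\<omega>. cf a j (?R \<omega>) * cnj (df b j (?R \<omega>)) \<partial>P) * of_real (v j)) =
        (\<Sum>j\<in>XI \<union> NI. if j = X_ent k b then (\<integral>\<omega>. cf a j (?R \<omega>) \<partial>P) else 0)"
        by (intro sum.cong refl) (auto simp: df_def v_def)
      also have "\<dots> = (\<integral>\<omega>. cf a (X_ent k b) (?R \<omega>) \<partial>P)" using k_lt fin by (auto simp: XI)
      also have "\<dots> = of_real (sqrt p) * (\<Sum>m<M. Z m k $ a $ b)"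
      proof -
        have "finite_moment P 1 (\<lambda>\<omega>. B (?R \<omega>) m k $ a $ b)" if "m < M" for m
          using finite_moment_mult[of P 1 "\<lambda>\<omega>. B (?R \<omega>) m k $ a $ b" "\<lambda>\<omega>. 1"] B2[OF that k_lt]
          by (simp add: finite_moment_def)
        then show ?thesis unfolding finite_moment_1 by (simp add: cf_def Z_B)
      qed
      finally show ?thesis by (simp add: E_def scaleR_conv_of_real[where 'a=complex])
    qed
    have "has_bochner_integral P (\<lambda>\<omega>. (\<Sum>j\<in>XI \<union> NI. cf a j (?R \<omega>) * \<xi> j \<omega>) * cnj (x k \<omega> $ b)) (E $ a $ b)"
      unfolding eq[symmetric] x_eq by (rule combination) (assumption | rule cf_meas df_meas cf2 df2)+
    then show "has_bochner_integral P (\<lambda>\<omega>. outer (s \<omega>) (x k \<omega>) $ a $ b) (E $ a $ b)"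
      by (simp add: outer_def s_eq cong: has_bochner_integral_cong)
  qed
  have ss: "has_bochner_integral P (\<lambda>\<omega>. outer (s \<omega>) (s \<omega>)) (Psi + E ** cadj E)"
  proof (intro has_bochner_integral_vecI)
    fix a b
    \<comment> \<open>The squared modulus of a sum over stations yields the double sum over
      \<open>m\<close> and \<open>m'\<close> in \<open>Psi\<close>, and the two factors
      \<open>sqrt p\<close> combine to \<open>p\<close>.\<close>
    have cfX: "(\<integral>\<omega>. cf a (X_ent l t) (?R \<omega>) * cnj (cf b (X_ent l t) (?R \<omega>)) \<partial>P) =
       of_real p * (\<Sum>m<M. \<Sum>m'<M. \<integral>\<omega>. B (?R \<omega>) m l $ a $ t * cnj (B (?R \<omega>) m' l $ b $ t) \<partial>P)" if l: "l < K" for l t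
    proof -
      have "cf a (X_ent l t) w * cnj (cf b (X_ent l t) w) =
        of_real p * (\<Sum>m<M. \<Sum>m'<M. B w m l $ a $ t * cnj (B w m' l $ b $ t))" for w
      proof -
        have "cf a (X_ent l t) w * cnj (cf b (X_ent l t) w) =
          of_real (sqrt p * sqrt p) * ((\<Sum>m<M. B w m l $ a $ t) * cnj (\<Sum>m'<M. B w m' l $ b $ t))"
          by (simp only: cf_def rv_index.case complex_cnj_mult complex_cnj_complex_of_real of_real_mult mult_ac)
        then show ?thesis
          using p_pos by (simp only: cnj_sum sum_product real_sqrt_mult_self abs_of_pos)
      qed
      then have "(\<integral>\<omega>. cf a (X_ent l t) (?R \<omega>) * cnj (cf b (X_ent l t) (?R \<omega>)) \<partial>P) =
        of_real p * (\<integral>\<omega>. (\<Sum>m<M. \<Sum>m'<M. B (?R \<omega>) m l $ a $ t * cnj (B (?R \<omega>) m' l $ b $ t)) \<partial>P)"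
        by simp
      also have "(\<integral>\<omega>. (\<Sum>m<M. \<Sum>m'<M. B (?R \<omega>) m l $ a $ t * cnj (B (?R \<omega>) m' l $ b $ t)) \<partial>P) =
        (\<Sum>m<M. \<Sum>m'<M. \<integral>\<omega>. B (?R \<omega>) m l $ a $ t * cnj (B (?R \<omega>) m' l $ b $ t) \<partial>P)"
        by (intro has_bochner_integral_integral_eq has_bochner_integral_sum has_bochner_integral_integrable
            integrable_mult_cnj B2) (use l in auto)
      finally show ?thesis .
    qed
    have "(\<Sum>j\<in>XI \<union> NI. (\<integral>\<omega>. cf a j (?R \<omega>) * cnj (cf b j (?R \<omega>)) \<partial>P) * of_real (v j)) =
      (\<Sum>l<K. \<Sum>t\<in>UNIV. of_real p * (\<Sum>m<M. \<Sum>m'<M. \<integral>\<omega>. B (?R \<omega>) m l $ a $ t * cnj (B (?R \<omega>) m' l $ b $ t) \<partial>P)) +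
      (\<Sum>m<M. \<Sum>r\<in>UNIV. (\<integral>\<omega>. cnj (Hw (?R \<omega>) m k $ r $ a) * Hw (?R \<omega>) m k $ r $ b \<partial>P) * of_real \<sigma>2)"
      unfolding sum_XN by (intro arg_cong2[where f="(+)"] sum.cong refl) (simp_all add: cfX v_def, simp add: cf_def)
    also have "\<dots> = of_real p * (\<Sum>l<K. \<Sum>m<M. \<Sum>m'<M. T m k m' l $ a $ b) + of_real \<sigma>2 * (\<Sum>m<M. Z m k $ a $ b)"
    proof -
      have "(\<Sum>t\<in>UNIV. \<Sum>m<M. \<Sum>m'<M. \<integral>\<omega>. B (?R \<omega>) m l $ a $ t * cnj (B (?R \<omega>) m' l $ b $ t) \<partial>P) =
         (\<Sum>m<M. \<Sum>m'<M. T m k m' l $ a $ b)" if "l < K" for l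
        using that by (subst sum.swap, intro sum.cong refl, subst sum.swap) (simp add: T_nth)
      then show ?thesis
        by (simp add: Z_nth sum_distrib_left[symmetric] sum_distrib_right[symmetric] mult.commute)
    qed
    \<comment> \<open>The term \<open>E ** cadj E\<close> subtracted in \<open>Psi\<close> is
      restored: the uncentred second moment of \<open>s\<close> is meant here.\<close>
    also have "\<dots> = (Psi + E ** cadj E) $ a $ b"
      by (simp add: Psi_def scaleR_conv_of_real[where 'a=complex])
    finally have eq: "(\<Sum>j\<in>XI \<union> NI. (\<integral>\<omega>. cf a j (?R \<omega>) * cnj (cf b j (?R \<omega>)) \<partial>P) * of_real (v j)) = (Psi + E ** cadj E) $ a $ b" .
    have "has_bochner_integral P (\<lambda>\<omega>. (\<Sum>j\<in>XI \<union> NI. cf a j (?R \<omega>) * \<xi> j \<omega>) * cnj (\<Sum>j\<in>XI \<union> NI. cf b j (?R \<omega>) * \<xi> j \<omega>))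
       ((Psi + E ** cadj E) $ a $ b)"
      unfolding eq[symmetric] by (rule combination) (assumption | rule cf_meas df_meas cf2 df2)+
    then show "has_bochner_integral P (\<lambda>\<omega>. outer (s \<omega>) (s \<omega>) $ a $ b) ((Psi + E ** cadj E) $ a $ b)"
      by (simp add: outer_def s_eq del: cnj_sum cong: has_bochner_integral_cong)
  qed

  \<comment> \<open>Law of the data vector and measurability\<close>
  have x_meas: "(\<lambda>\<omega>. x k \<omega> $ t) \<in> borel_measurable P" for t
    using \<xi>_meas[of "X_ent k t"] k_lt by (simp add: XI \<xi>_def[abs_def])
  have law: "distr P (\<Pi>\<^sub>M i\<in>(UNIV :: 's set). borel) (\<lambda>\<omega> i. x k \<omega> $ i) = (\<Pi>\<^sub>M i\<in>(UNIV :: 's set). complex_normal 1)"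
  proof -
    \<comment> \<open>Singleton blocks reindex the subfamily by the components \<open>t\<close> of
      \<open>x k\<close>, so that its joint law becomes a product over \<open>UNIV\<close>.\<close>
    have "indep_vars (\<lambda>t. \<Pi>\<^sub>M i\<in>{X_ent k t}. borel) (\<lambda>t \<omega>. restrict (\<lambda>i. \<xi> i \<omega>) {X_ent k t}) (UNIV :: 's set)"
      by (rule indep_vars_restrict[OF ind]) (use k_lt in \<open>auto simp: XI disjoint_family_on_def\<close>)
    then have "indep_vars (\<lambda>t. borel) (\<lambda>t \<omega>. restrict (\<lambda>i. \<xi> i \<omega>) {X_ent k t} (X_ent k t)) (UNIV :: 's set)"
      by (rule indep_vars_compose2[where Y="\<lambda>t w. w (X_ent k t)"]) auto
    then have "indep_vars (\<lambda>t. borel) (\<lambda>t \<omega>. x k \<omega> $ t) (UNIV :: 's set)"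
      by (simp add: \<xi>_simps)
    then show ?thesis
      using indep_vars_iff_distr_eq_PiM'[where I="UNIV :: 's set" and M'="\<lambda>_. borel" and X="\<lambda>t \<omega>. x k \<omega> $ t"] x_meas
      by (simp add: x_dist k_lt restrict_UNIV)
  qed
  have s_meas: "s \<in> borel_measurable P"
  proof (rule borel_measurable_vecI)
    fix a
    have "(\<lambda>\<omega>. \<Sum>j\<in>XI \<union> NI. cf a j (?R \<omega>) * \<xi> j \<omega>) \<in> borel_measurable P"
      using cf2 \<xi>_meas by (intro borel_measurable_sum borel_measurable_times) (auto simp: finite_moment_def)
    then show "(\<lambda>\<omega>. s \<omega> $ a) \<in> borel_measurable P"
      by (simp add: s_eq cong: measurable_cong)
  qed
  have xhat_meas: "xhat k \<in> borel_measurable P"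
    using borel_measurable_scaleR[OF borel_measurable_const s_meas, of "1 / real M"]
    by (simp add: xhat_def[OF k_lt] s_def cong: measurable_cong)
  \<comment> \<open>For \<open>M = 0\<close> the sum is empty and the factor \<open>real M\<close>
    is 0, so both sides vanish.\<close>
  have s_xhat: "s \<omega> = real M *\<^sub>R xhat k \<omega>" if "\<omega> \<in> space P" for \<omega>
    using that by (cases "M = 0") (simp_all add: xhat_def[OF k_lt] s_def)
  show ?thesis
    unfolding SE_def
    by (rule log_det_le_mutual_information_ext[OF law borel_measurable_vecI[OF x_meas] xhat_meas s_xhat XX sX ss Psi_inv])
qed

end
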